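(* Let $n$ be a positive integer, let $(\mathcal{P},\mathcal{L})$ be a connected Fischer space of rank $n$, and let $\mathbb{F}$ be a field of characteristic $3$. Then the Matsuo algebra $M((\mathcal{P},\mathcal{L}),\frac14,\mathbb{F})$ is a Jordan algebra if and only if $(\mathcal{P},\mathcal{L})$ is isomorphic to either the Fischer space associated with the $3$-transposition group $(\mathit{Sym}(n+1),(1,2)^{\mathit{Sym}(n+1)})$, or the $(n-1)$-dimensional affine space $AG(n-1,3)$ of order three.
   Context: Partial triple systems. A partial triple system is a pair $(\mathcal{P},\mathcal{L})$ where $\mathcal{P}$ is a set (of points) and $\mathcal{L}$ is a set of $3$-element subsets of $\mathcal{P}$ (lines) such that $|l_1\cap l_2|\le 1$ for all distinct $l_1,l_2\in\mathcal{L}$. Two distinct points are collinear if they lie on a common line. A subsystem of $(\mathcal{P},\mathcal{L})$ is a partial triple system $(\mathcal{P}',\mathcal{L}')$ with $\mathcal{P}'\subset\mathcal{P}$ and $\mathcal{L}\supset\mathcal{L}'\supset\{l\in\mathcal{L} : |l\cap\mathcal{P}'|\ge 2\}$. The subsystem generated by a subset $S\subset\mathcal{P}$ is the minimum subsystem whose point set contains $S$. The rank of $(\mathcal{P},\mathcal{L})$ is the minimum size of a subset of $\mathcal{P}$ generating $(\mathcal{P},\mathcal{L})$ itself. A plane is a subsystem generated by $l_1\cup l_2$ for two distinct intersecting lines $l_1,l_2$. Two partial triple systems are isomorphic if there is a bijection between the point sets inducing a bijection between the line sets. $(\mathcal{P},\mathcal{L})$ is connected if the equivalence relation on $\mathcal{P}$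 generated by collinearity has exactly one class. Examples. The dual affine plane $DA(2,2)$ of order two has point set $\{p,q,r,s,t,u\}$ (six distinct points) and line set $\{\{p,r,s\},\{p,t,u\},\{q,r,t\},\{q,s,u\}\}$. The affine space $AG(m,3)$ of order three ($m\ge 0$) has point set $\mathbb{F}_3^m$ and line set $\{\{x,y,-x-y\} : x,y\in\mathbb{F}_3^m,\ x\ne y\}$. Fischer spaces. A Fischer space is a partial triple system each of whose planes is isomorphic to $DA(2,2)$ or $AG(2,3)$. A $3$-transposition group is a pair $(G,D)$ with $G$ a group and $D$ a conjugation-invariant subset of $G$ such that $|g|=2$ and $|gh|\le 3$ for all $g,h\in D$. The Fischer space associated with $(G,D)$ has point set $D$ and line set $\{\{c,d,d^{-1}cd\} : c,d\in D,\ |cd|=3\}$. Here $(1,2)^{\mathit{Sym}(n+1)}$ denotes the set of all transpositions in the symmetric group $\mathit{Sym}(n+1)$. Matsuo algebras. For a partial triple system $(\mathcal{P},\mathcal{L})$, a field $\mathbb{F}$ of characteristic not $2$ and $\delta\in\mathbb{F}$, the Matsuo algebra $M((\mathcal{P},\mathcal{L}),\delta,\mathbb{F})$ is the $\mathbb{F}$-vector space with basis $\{a(p) : p\in\mathcal{P}\}$ and bilinear multiplication given by: $a(p)a(p)=a(p)$; $a(p)a(q)=0$ if $p\ne q$ are not collinear; $a(p)a(q)=\delta(a(p)+a(q)-a(r))$ if $p,q$ are collinear and $\{p,q,r\}$ is the line containing them. A Jordan algebra is a commutative, not necessarily associative, algebra $A$ satisfying $(a^2b)a=a^2(ba)$ for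 all $a,b\in A$. *)

theory Defs
  imports
    "HOL-Library.Poly_Mapping"
    "HOL-Library.Numeral_Type"
    "HOL-Algebra.Sym_Groups"
    "HOL-Algebra.Multiplicative_Group"
begin

section \<open>Partial triple systems\<close>

definition partial_triple_system :: "'a set \<Rightarrow> 'a set set \<Rightarrow> bool" where
  "partial_triple_system P L \<longleftrightarrow>
     (\<forall>l\<in>L. l \<subseteq> P \<and> card l = 3) \<and>
     (\<forall>l1\<in>L. \<forall>l2\<in>L. l1 \<noteq> l2 \<longrightarrow> card (l1 \<inter> l2) \<le> 1)"

definition collinear :: "'a set set \<Rightarrow> 'a \<Rightarrow> 'a \<Rightarrow> bool" where
  "collinear L p q \<longleftrightarrow> p \<noteq> q \<and> (\<exists>l\<in>L. p \<in> l \<and> q \<in> l)"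

definition subsystem :: "'a set \<Rightarrow> 'a set set \<Rightarrow> 'a set \<Rightarrow> 'a set set \<Rightarrow> bool" where
  "subsystem P' L' P L \<longleftrightarrow>
     partial_triple_system P' L' \<and> P' \<subseteq> P \<and> L' \<subseteq> L \<and> {l\<in>L. card (l \<inter> P') \<ge> 2} \<subseteq> L'"

text \<open>\<open>(P', L')\<close> is the minimum subsystem of \<open>(P, L)\<close> whose point set contains \<open>S\<close>.\<close>

definition generated_subsystem ::
    "'a set \<Rightarrow> 'a set set \<Rightarrow> 'a set \<Rightarrow> 'a set \<Rightarrow> 'a set set \<Rightarrow> bool" where
  "generated_subsystem P L S P' L' \<longleftrightarrow>
     subsystem P' L' P L \<and> S \<subseteq> P' \<and>
     (\<forall>P'' L''. subsystem P'' L'' P L \<and> S \<subseteq> P'' \<longrightarrow> P' \<subseteq> P'' \<and> L' \<subseteq> L'')"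

text \<open>A predicate rather than a number, so that a system without a finite generating set
  has no natural number as its rank.\<close>

definition has_rank :: "'a set \<Rightarrow> 'a set set \<Rightarrow> nat \<Rightarrow> bool" where
  "has_rank P L n \<longleftrightarrow>
     (\<exists>S\<subseteq>P. finite S \<and> card S = n \<and> generated_subsystem P L S P L) \<and>
     (\<forall>S\<subseteq>P. finite S \<and> generated_subsystem P L S P L \<longrightarrow> n \<le> card S)"

definition plane :: "'a set \<Rightarrow> 'a set set \<Rightarrow> 'a set \<Rightarrow> 'a set set \<Rightarrow> bool" where
  "plane P L P' L' \<longleftrightarrow>
     (\<exists>l1\<in>L. \<exists>l2\<in>L. l1 \<noteq> l2 \<and> l1 \<inter> l2 \<noteq> {} \<and> generated_subsystem P L (l1 \<union> l2) P' L')"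

definition isomorphic_systems ::
    "'a set \<Rightarrow> 'a set set \<Rightarrow> 'b set \<Rightarrow> 'b set set \<Rightarrow> bool" where
  "isomorphic_systems P L P' L' \<longleftrightarrow>
     (\<exists>f. bij_betw f P P' \<and> bij_betw (\<lambda>l. f ` l) L L')"

definition connected_system :: "'a set \<Rightarrow> 'a set set \<Rightarrow> bool" where
  "connected_system P L \<longleftrightarrow>
     card (P // {(p, q). p \<in> P \<and> q \<in> P \<and> equivclp (collinear L) p q}) = 1"


section \<open>Dual affine plane of order two, affine spaces of order three\<close>

text \<open>The points \<open>p, q, r, s, t, u\<close> are \<open>0, 1, 2, 3, 4, 5\<close>.\<close>

definition dual_affine_points :: "nat set" where
  "dual_affine_points = {0, 1, 2, 3, 4, 5}"

definition dual_affine_lines :: "nat set set" where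
  "dual_affine_lines = {{0, 2, 3}, {0, 4, 5}, {1, 2, 4}, {1, 3, 5}}"

text \<open>The numeral type \<open>3\<close> carries arithmetic modulo 3; a vector with \<open>m\<close> coordinates is a
  sequence vanishing from index \<open>m\<close> on.\<close>

definition affine_points :: "nat \<Rightarrow> (nat \<Rightarrow> 3) set" where
  "affine_points m = {x. \<forall>i\<ge>m. x i = 0}"

definition affine_lines :: "nat \<Rightarrow> (nat \<Rightarrow> 3) set set" where
  "affine_lines m =
     {{x, y, (\<lambda>i. - x i - y i)} | x y. x \<in> affine_points m \<and> y \<in> affine_points m \<and> x \<noteq> y}"


section \<open>Fischer spaces\<close>

definition fischer_space :: "'a set \<Rightarrow> 'a set set \<Rightarrow> bool" where
  "fischer_space P L \<longleftrightarrow>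
     partial_triple_system P L \<and>
     (\<forall>P' L'. plane P L P' L' \<longrightarrow>
        isomorphic_systems P' L' dual_affine_points dual_affine_lines \<or>
        isomorphic_systems P' L' (affine_points 2) (affine_lines 2))"

text \<open>The Fischer space associated with a 3-transposition group \<open>(G, D)\<close> has point set \<open>D\<close>
  and the following lines.\<close>

definition fischer_lines :: "('g, 'm) monoid_scheme \<Rightarrow> 'g set \<Rightarrow> 'g set set" where
  "fischer_lines G D =
     {{c, d, inv\<^bsub>G\<^esub> d \<otimes>\<^bsub>G\<^esub> c \<otimes>\<^bsub>G\<^esub> d} | c d. c \<in> D \<and> d \<in> D \<and> group.ord G (c \<otimes>\<^bsub>G\<^esub> d) = 3}"

text \<open>The transpositions in \<open>sym_group m\<close>, which acts on \<open>{1..m}\<close>.\<close>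

definition transpositions :: "nat \<Rightarrow> (nat \<Rightarrow> nat) set" where
  "transpositions m = {transpose i j | i j. i \<in> {1..m} \<and> j \<in> {1..m} \<and> i \<noteq> j}"


section \<open>Matsuo algebras\<close>

definition pm_scale :: "'f::field \<Rightarrow> ('a \<Rightarrow>\<^sub>0 'f) \<Rightarrow> ('a \<Rightarrow>\<^sub>0 'f)" where
  "pm_scale c x = Poly_Mapping.map ((*) c) x"

definition matsuo_carrier :: "'a set \<Rightarrow> ('a \<Rightarrow>\<^sub>0 'f::field) set" where
  "matsuo_carrier P = {x. Poly_Mapping.keys x \<subseteq> P}"

definition axis :: "'a \<Rightarrow> ('a \<Rightarrow>\<^sub>0 'f::field)" where
  "axis p = Poly_Mapping.single p 1"

definition third_point :: "'a set set \<Rightarrow> 'a \<Rightarrow> 'a \<Rightarrow> 'a" where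
  "third_point L p q = (THE r. {p, q, r} \<in> L)"

definition axis_mult :: "'a set set \<Rightarrow> 'f::field \<Rightarrow> 'a \<Rightarrow> 'a \<Rightarrow> ('a \<Rightarrow>\<^sub>0 'f)" where
  "axis_mult L \<delta> p q =
     (if p = q then axis p
      else if collinear L p q then pm_scale \<delta> (axis p + axis q - axis (third_point L p q))
      else 0)"

definition matsuo_mult ::
    "'a set set \<Rightarrow> 'f::field \<Rightarrow> ('a \<Rightarrow>\<^sub>0 'f) \<Rightarrow> ('a \<Rightarrow>\<^sub>0 'f) \<Rightarrow> ('a \<Rightarrow>\<^sub>0 'f)" where
  "matsuo_mult L \<delta> x y =
     (\<Sum>p\<in>Poly_Mapping.keys x. \<Sum>q\<in>Poly_Mapping.keys y.
        pm_scale (Poly_Mapping.lookup x p * Poly_Mapping.lookup y q) (axis_mult L \<delta> p q))"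


section \<open>Jordan algebras\<close>

definition algebra_on ::
    "('f::field \<Rightarrow> 'v::ab_group_add \<Rightarrow> 'v) \<Rightarrow> 'v set \<Rightarrow> ('v \<Rightarrow> 'v \<Rightarrow> 'v) \<Rightarrow> bool" where
  "algebra_on sc A mul \<longleftrightarrow>
     vector_space sc \<and> module.subspace sc A \<and>
     (\<forall>x\<in>A. \<forall>y\<in>A. mul x y \<in> A) \<and>
     (\<forall>x\<in>A. \<forall>y\<in>A. \<forall>z\<in>A. mul (x + y) z = mul x z + mul y z \<and> mul x (y + z) = mul x y + mul x z) \<and>
     (\<forall>c. \<forall>x\<in>A. \<forall>y\<in>A. mul (sc c x) y = sc c (mul x y) \<and> mul x (sc c y) = sc c (mul x y))"

definition jordan_algebra ::
    "('f::field \<Rightarrow> 'v::ab_group_add \<Rightarrow> 'v) \<Rightarrow> 'v set \<Rightarrow> ('v \<Rightarrow> 'v \<Rightarrow> 'v) \<Rightarrow> bool" where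
  "jordan_algebra sc A mul \<longleftrightarrow>
     algebra_on sc A mul \<and>
     (\<forall>a\<in>A. \<forall>b\<in>A. mul a b = mul b a) \<and>
     (\<forall>a\<in>A. \<forall>b\<in>A. mul (mul (mul a a) b) a = mul (mul a a) (mul b a))"

end

theory Submission
  imports Defs "HOL-Library.Function_Algebras" "HOL-Computational_Algebra.Primes"
begin

text \<open>
  In characteristic 3 the parameter 1/4 is 1, so collinear axes multiply as \<open>a(p) a(q) = a(p) + a(q) - a(r)\<close>.
  For an affine space the Matsuo algebra is the group algebra of \<open>(\<int>/3)\<^sup>m\<close> with a twisted product, and the
  Jordan identity reduces to the fact that cubes in the group algebra are scalars. For the symmetric group,
  sending the transposition \<open>\<tau>\<close> to the projection \<open>(1 - \<tau>)/2\<close> of the permutation representation embeds the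
  Matsuo algebra into a special Jordan algebra.

  Conversely, the Jordan identity is linearized and its coefficients are compared. Let \<open>t\<close> be a point
  outside a plane. If the plane is affine, \<open>t\<close> is collinear with all of its points or with none, so by
  connectedness affine and dual affine planes cannot both occur. If there is an affine plane, the linearized
  identity gives the medial law for the operation ``third point on the line'', which makes the space an affine
  space over the field with three elements. If all planes are dual affine, view such a plane as the six edges
  of a complete graph on four vertices; each of its three pairs of opposite edges contains the same number of
  points collinear with \<open>t\<close>. Hence the points collinear with \<open>t\<close> in a subsystem formed by the
  edges of a complete graph form the star of a vertex, and adding \<open>t\<close> yields the edges of a complete graph
  with one more vertex. In both cases the space is exhausted by adding the points of a minimal generating set
  one at a time.
\<close>

section \<open>Partial triple systems and their subsystems\<close>

definition line_closed :: "'a set set \<Rightarrow> 'a set \<Rightarrow> bool" where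
  "line_closed L Q \<longleftrightarrow> (\<forall>p q r. {p, q, r} \<in> L \<longrightarrow> p \<in> Q \<longrightarrow> q \<in> Q \<longrightarrow> r \<in> Q)"

abbreviation line_hull :: "'a set set \<Rightarrow> 'a set \<Rightarrow> 'a set" where
  "line_hull L S \<equiv> line_closed L hull S"

lemma line_closedD: "line_closed L Q \<Longrightarrow> {p, q, r} \<in> L \<Longrightarrow> p \<in> Q \<Longrightarrow> q \<in> Q \<Longrightarrow> r \<in> Q"
  unfolding line_closed_def by blast

lemma line_closed_hull: "line_closed L (line_hull L S)"
proof (rule hull_in)
  fix F assume "\<forall>Q\<in>F. line_closed L Q"
  then show "line_closed L (\<Inter> F)" unfolding line_closed_def by blast
qed

locale triple_system =
  fixes P :: "'a set" and L :: "'a set set"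
  assumes partial_triple_system: "partial_triple_system P L"
begin

abbreviation col :: "'a \<Rightarrow> 'a \<Rightarrow> bool" where "col \<equiv> collinear L"

abbreviation third :: "'a \<Rightarrow> 'a \<Rightarrow> 'a" where "third \<equiv> third_point L"

lemma line_card: "l \<in> L \<Longrightarrow> card l = 3" and line_subset: "l \<in> L \<Longrightarrow> l \<subseteq> P"
  using partial_triple_system unfolding partial_triple_system_def by auto

lemma lines_within_points: "{l \<in> L. l \<subseteq> P} = L"
  using line_subset by blast

lemma line_distinct:
  assumes "{p, q, r} \<in> L"
  shows "p \<noteq> q" "p \<noteq> r" "q \<noteq> r"
  using line_card[OF assms] by (auto simp: card_insert_if split: if_splits)

lemma line_points:
  assumes "{p, q, r} \<in> L"
  shows "p \<in> P" "q \<in> P" "r \<in> P"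
  using line_subset[OF assms] by auto

lemma line_eqI:
  assumes "l \<in> L" "m \<in> L" "p \<in> l" "q \<in> l" "p \<in> m" "q \<in> m" "p \<noteq> q"
  shows "l = m"
proof (rule ccontr)
  assume "l \<noteq> m"
  then have "card (l \<inter> m) \<le> 1"
    using partial_triple_system assms unfolding partial_triple_system_def by auto
  moreover have "finite (l \<inter> m)"
    using line_card[OF assms(1)] by (metis card.infinite finite_Int zero_neq_numeral)
  ultimately have "p = q"
    using assms by (intro card_le_Suc0_iff_eq[THEN iffD1, rule_format, of "l \<inter> m"]) auto
  then show False using assms by simp
qed

lemma line_unique: "{p, q, r} \<in> L \<Longrightarrow> {p, q, s} \<in> L \<Longrightarrow> r = s"
  using line_eqI[of "{p, q, r}" "{p, q, s}" p q] line_distinct by (metis insertCI insertE singletonD)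

lemma lineE:
  assumes "l \<in> L"
  obtains p q r where "l = {p, q, r}"
  using line_card[OF assms] by (auto simp: card_3_iff)

lemma line_thirdE:
  assumes "l \<in> L" "p \<in> l" "q \<in> l" "p \<noteq> q"
  obtains r where "l = {p, q, r}"
proof -
  have "card (l - {p, q}) = 1"
    using assms line_card[OF assms(1)] by (simp add: card_Diff_subset)
  then obtain r where "l - {p, q} = {r}" by (rule card_1_singletonE)
  then have "l = {p, q, r}" using assms by auto
  then show ?thesis by (rule that)
qed

lemma col_iff: "col p q \<longleftrightarrow> (\<exists>r. {p, q, r} \<in> L)"
proof
  assume "col p q"
  then show "\<exists>r. {p, q, r} \<in> L" unfolding collinear_def by (metis line_thirdE)
next
  assume "\<exists>r. {p, q, r} \<in> L"
  then show "col p q" unfolding collinear_def using line_distinct by blast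
qed

lemma col_sym: "col p q \<longleftrightarrow> col q p"
  unfolding collinear_def by auto

lemma col_points: "col p q \<Longrightarrow> p \<in> P" "col p q \<Longrightarrow> q \<in> P"
  by (auto simp: col_iff dest: line_points)

lemma line_col:
  assumes "{p, q, r} \<in> L"
  shows "col p q" "col q p" "col p r" "col r p" "col q r" "col r q"
  using line_distinct[OF assms] unfolding collinear_def by (auto intro!: bexI[OF _ assms])

lemma third_eq: "{p, q, r} \<in> L \<Longrightarrow> third p q = r"
  unfolding third_point_def by (auto intro: line_unique)

lemma third_line: "col p q \<Longrightarrow> {p, q, third p q} \<in> L"
  unfolding col_iff using third_eq by auto

lemma third_commute: "third p q = third q p"
  unfolding third_point_def by (simp add: insert_commute)

lemma line_closed_points: "line_closed L P"
  unfolding line_closed_def using line_points by blast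

lemma line_hull_subset: "S \<subseteq> P \<Longrightarrow> line_hull L S \<subseteq> P"
  using hull_minimal[of S P "line_closed L"] line_closed_points by blast

lemma line_closed_singleton: "line_closed L {p}"
  unfolding line_closed_def using line_distinct by blast

lemma line_closed_subset:
  assumes "line_closed L Q" "l \<in> L" "2 \<le> card (l \<inter> Q)"
  shows "l \<subseteq> Q"
proof -
  have "\<not> card (l \<inter> Q) \<le> Suc 0" using assms(3) by simp
  moreover have "finite (l \<inter> Q)" using assms(3) by (metis card.infinite not_numeral_le_zero)
  ultimately obtain p q where two_points: "p \<in> l \<inter> Q" "q \<in> l \<inter> Q" "p \<noteq> q"
    using card_le_Suc0_iff_eq by blast
  then obtain r where "l = {p, q, r}" using line_thirdE[OF assms(2)] by blast
  then show ?thesis using line_closedD[OF assms(1), of p q r] assms(2) two_points by auto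
qed

lemma subsystem_iff:
  "subsystem Q M P L \<longleftrightarrow> Q \<subseteq> P \<and> line_closed L Q \<and> M = {l \<in> L. l \<subseteq> Q}"
proof
  assume subsystem: "subsystem Q M P L"
  have two_common_points: "2 \<le> card (l \<inter> Q)" if "{p, q} \<subseteq> l \<inter> Q" "l \<in> L" "p \<noteq> q" for l p q
  proof -
    have "finite l" using line_card[OF that(2)] by (metis card.infinite zero_neq_numeral)
    then show ?thesis using card_mono[OF _ that(1)] that(3) by simp
  qed
  have lines: "M \<subseteq> L" "\<And>l. l \<in> M \<Longrightarrow> l \<subseteq> Q" "\<And>l. l \<in> L \<Longrightarrow> 2 \<le> card (l \<inter> Q) \<Longrightarrow> l \<in> M"
    using subsystem unfolding subsystem_def partial_triple_system_def by auto
  have "line_closed L Q"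
    unfolding line_closed_def
  proof (intro allI impI)
    fix p q r assume line: "{p, q, r} \<in> L" "p \<in> Q" "q \<in> Q"
    then have "2 \<le> card ({p, q, r} \<inter> Q)"
      using two_common_points[of p q] line_distinct(1)[OF line(1)] by blast
    then show "r \<in> Q" using lines(2,3) line(1) by blast
  qed
  moreover have "l \<in> M" if "l \<in> L" "l \<subseteq> Q" for l
    using that line_card[of l] by (intro lines(3)) (simp_all add: Int_absorb2)
  ultimately show "Q \<subseteq> P \<and> line_closed L Q \<and> M = {l \<in> L. l \<subseteq> Q}"
    using subsystem lines(1,2) unfolding subsystem_def by auto
next
  assume closed: "Q \<subseteq> P \<and> line_closed L Q \<and> M = {l \<in> L. l \<subseteq> Q}"
  then have "partial_triple_system Q M"
    using partial_triple_system unfolding partial_triple_system_def by auto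
  then show "subsystem Q M P L"
    using closed line_closed_subset unfolding subsystem_def by auto
qed

lemma generated_subsystem_iff:
  "generated_subsystem P L S Q M \<longleftrightarrow> S \<subseteq> P \<and> Q = line_hull L S \<and> M = {l \<in> L. l \<subseteq> Q}"
proof
  assume generated: "generated_subsystem P L S Q M"
  then have hull: "Q \<subseteq> P" "line_closed L Q" "M = {l \<in> L. l \<subseteq> Q}" "S \<subseteq> Q"
    unfolding generated_subsystem_def subsystem_iff by auto
  then have generators: "S \<subseteq> P" by blast
  have "subsystem (line_hull L S) {l \<in> L. l \<subseteq> line_hull L S} P L"
    using line_hull_subset[OF generators] line_closed_hull by (simp add: subsystem_iff)
  then have "Q \<subseteq> line_hull L S"
    using generated hull_subset unfolding generated_subsystem_def by metis
  moreover have "line_hull L S \<subseteq> Q" using hull by (intro hull_minimal)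
  ultimately show "S \<subseteq> P \<and> Q = line_hull L S \<and> M = {l \<in> L. l \<subseteq> Q}" using hull generators by blast
next
  assume hull: "S \<subseteq> P \<and> Q = line_hull L S \<and> M = {l \<in> L. l \<subseteq> Q}"
  then have "subsystem Q M P L"
    using line_hull_subset line_closed_hull by (simp add: subsystem_iff)
  moreover have "Q \<subseteq> R \<and> M \<subseteq> N" if "subsystem R N P L \<and> S \<subseteq> R" for R N
  proof -
    have "Q \<subseteq> R" using hull that by (simp add: hull_minimal subsystem_iff)
    then show ?thesis using hull that by (auto simp: subsystem_iff)
  qed
  ultimately show "generated_subsystem P L S Q M"
    using hull hull_subset[of S "line_closed L"] unfolding generated_subsystem_def by metis
qed

lemma generates_iff: "generated_subsystem P L S P L \<longleftrightarrow> S \<subseteq> P \<and> line_hull L S = P"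
  unfolding generated_subsystem_iff lines_within_points by auto

lemma has_rank_induct [consumes 2, case_names point insert]:
  assumes "has_rank P L n" "n > 0"
    and point: "\<And>p. p \<in> P \<Longrightarrow> R 0 {p}"
    and insert: "\<And>k Q S. R k Q \<Longrightarrow> line_closed L Q \<Longrightarrow> Q \<noteq> {} \<Longrightarrow> Q \<subset> P \<Longrightarrow> S \<subseteq> P \<Longrightarrow>
      line_hull L S = P \<Longrightarrow> \<exists>s\<in>S - Q. R (Suc k) (line_hull L (insert s Q))"
  shows "R (n - 1) P"
proof -
  obtain S where generators: "S \<subseteq> P" "finite S" "card S = n" "line_hull L S = P"
    using assms(1) unfolding has_rank_def generates_iff by auto
  have minimal: "n \<le> card T" if "T \<subseteq> P" "finite T" "line_hull L T = P" for T
    using assms(1) that unfolding has_rank_def generates_iff by auto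
  define F where "F = {T. T \<subseteq> S \<and> T \<noteq> {} \<and> R (card T - 1) (line_hull L T)}"
  obtain p where p_in_S: "p \<in> S" using generators(3) \<open>n > 0\<close> by fastforce
  have "line_hull L {p} = {p}" by (rule hull_same) (rule line_closed_singleton)
  then have "{p} \<in> F" using generators(1) p_in_S point[of p] unfolding F_def by auto
  moreover have "finite F"
    using generators(2) unfolding F_def by (rule rev_finite_subset[OF finite_Pow_iff[THEN iffD2]]) blast
  ultimately obtain T where T_in_F: "T \<in> F" and maximal: "\<And>T'. T' \<in> F \<Longrightarrow> T \<subseteq> T' \<Longrightarrow> T = T'"
    using finite_has_maximal[of F] by blast
  define Q where "Q = line_hull L T"
  have T_nonempty_subset: "T \<subseteq> S" "T \<noteq> {}" and R_Q: "R (card T - 1) Q"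
    using T_in_F unfolding F_def Q_def by auto
  have "finite T" "T \<subseteq> P" using T_nonempty_subset(1) generators(1,2) finite_subset by blast+
  have "T \<subseteq> Q" unfolding Q_def by (rule hull_subset)
  have "Q = P"
  proof (rule ccontr)
    assume "Q \<noteq> P"
    then have "Q \<subset> P" using line_hull_subset[OF \<open>T \<subseteq> P\<close>] unfolding Q_def by blast
    moreover have "line_closed L Q" unfolding Q_def by (rule line_closed_hull)
    moreover have "Q \<noteq> {}" using \<open>T \<subseteq> Q\<close> T_nonempty_subset(2) by blast
    ultimately obtain s where new_point: "s \<in> S - Q" "R (Suc (card T - 1)) (line_hull L (Set.insert s Q))"
      using insert[OF R_Q _ _ _ generators(1,4)] by blast
    have "s \<notin> T" using new_point(1) \<open>T \<subseteq> Q\<close> by blast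
    then have "card (Set.insert s T) - 1 = Suc (card T - 1)"
      using \<open>finite T\<close> T_nonempty_subset(2) by (simp add: card_gt_0_iff)
    moreover have "line_hull L (Set.insert s Q) = line_hull L (Set.insert s T)"
      unfolding Q_def by (rule hull_insert[symmetric])
    ultimately have "Set.insert s T \<in> F" using new_point T_nonempty_subset(1) unfolding F_def by auto
    then show False using maximal \<open>s \<notin> T\<close> by blast
  qed
  then have "n \<le> card T" using minimal[OF \<open>T \<subseteq> P\<close> \<open>finite T\<close>] unfolding Q_def by simp
  moreover have "card T \<le> n" using card_mono[OF generators(2) T_nonempty_subset(1)] generators(3) by simp
  ultimately show ?thesis using R_Q \<open>Q = P\<close> by simp
qed

end

lemma connected_systemD:
  assumes "connected_system P L" "p \<in> P" "q \<in> P"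
  shows "equivclp (collinear L) p q"
proof -
  let ?R = "{(p, q). p \<in> P \<and> q \<in> P \<and> equivclp (collinear L) p q}"
  obtain X where one_class: "P // ?R = {X}"
    using assms(1) unfolding connected_system_def by (rule card_1_singletonE)
  have "?R `` {p} \<in> P // ?R" "?R `` {q} \<in> P // ?R"
    using assms(2,3) by (auto intro!: quotientI simp del: Image_Collect_case_prod)
  then have "?R `` {p} = ?R `` {q}" using one_class by auto
  moreover have "q \<in> ?R `` {q}" using assms(3) by auto
  ultimately have "q \<in> ?R `` {p}" by simp
  then show ?thesis by simp
qed

lemma connected_system_induct [consumes 3, case_names base step]:
  assumes "connected_system P L" "p \<in> P" "q \<in> P"
    and base: "R p" and step: "\<And>x y. R x \<Longrightarrow> collinear L x y \<Longrightarrow> R y"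
  shows "R q"
  using connected_systemD[OF assms(1-3)]
proof (induction rule: equivclp_induct)
  case (step y z)
  then show ?case using assms(5) unfolding collinear_def by metis
qed (rule base)

section \<open>Isomorphisms\<close>

lemma isomorphic_systemsI:
  assumes bijection: "bij_betw f P P'" and lines: "(\<lambda>l. f ` l) ` L = L'" and subsets: "L \<subseteq> Pow P"
  shows "isomorphic_systems P L P' L'"
proof -
  have "inj_on (\<lambda>l. f ` l) (Pow P)"
    using bijection by (simp add: bij_betw_def inj_on_image_Pow)
  then have "bij_betw (\<lambda>l. f ` l) L L'"
    using lines subsets unfolding bij_betw_def by (meson inj_on_subset)
  then show ?thesis using bijection unfolding isomorphic_systems_def by blast
qed

lemma isomorphic_systems_sym:
  assumes "isomorphic_systems P L P' L'" and subsets: "L \<subseteq> Pow P"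
  shows "isomorphic_systems P' L' P L"
proof -
  obtain f where bijection: "bij_betw f P P'" "bij_betw (\<lambda>l. f ` l) L L'"
    using assms unfolding isomorphic_systems_def by blast
  let ?g = "inv_into P f"
  have inverse: "?g ` f ` l = l" if "l \<in> L" for l
    using bijection(1) that subsets by (intro inv_into_image_cancel) (auto simp: bij_betw_def)
  have image_lines: "L' = (\<lambda>l. f ` l) ` L" using bijection(2) by (simp add: bij_betw_def)
  have "(\<lambda>l. ?g ` l) ` L' = L" unfolding image_lines image_image using inverse by (simp add: image_image)
  moreover have "L' \<subseteq> Pow P'" unfolding image_lines using bijection(1) subsets by (fastforce simp: bij_betw_def)
  ultimately show ?thesis using isomorphic_systemsI[OF bij_betw_inv_into[OF bijection(1)]] by blast
qed

lemma isomorphic_systemsE: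
  assumes "isomorphic_systems P L P' L'" and subsets: "L \<subseteq> Pow P"
  obtains f where "bij_betw f P P'"
    "\<And>p q r. p \<in> P \<Longrightarrow> q \<in> P \<Longrightarrow> r \<in> P \<Longrightarrow> {f p, f q, f r} \<in> L' \<longleftrightarrow> {p, q, r} \<in> L"
proof -
  obtain f where bijection: "bij_betw f P P'" "bij_betw (\<lambda>l. f ` l) L L'"
    using assms unfolding isomorphic_systems_def by blast
  have "{f p, f q, f r} \<in> L' \<longleftrightarrow> {p, q, r} \<in> L" if "p \<in> P" "q \<in> P" "r \<in> P" for p q r
  proof -
    have "{f p, f q, f r} \<in> L' \<longleftrightarrow> f ` {p, q, r} \<in> (\<lambda>l. f ` l) ` L"
      using bijection(2) by (simp add: bij_betw_def)
    also have "\<dots> \<longleftrightarrow> {p, q, r} \<in> L"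
      using bijection(1) subsets that unfolding bij_betw_def
      by (intro inj_on_image_mem_iff[of _ "Pow P"]) (auto intro: inj_on_image_Pow)
    finally show ?thesis .
  qed
  then show ?thesis using that bijection(1) by blast
qed

lemma (in triple_system) isomorphic_subsystemE:
  assumes "isomorphic_systems Q {l \<in> L. l \<subseteq> Q} X M" and subsets: "M \<subseteq> Pow X"
  obtains f where "bij_betw f X Q"
    "\<And>x y z. x \<in> X \<Longrightarrow> y \<in> X \<Longrightarrow> z \<in> X \<Longrightarrow> {f x, f y, f z} \<in> L \<longleftrightarrow> {x, y, z} \<in> M"
proof -
  have "isomorphic_systems X M Q {l \<in> L. l \<subseteq> Q}"
    using assms(1) by (rule isomorphic_systems_sym) blast
  then obtain f where bijection: "bij_betw f X Q"
    "\<And>x y z. x \<in> X \<Longrightarrow> y \<in> X \<Longrightarrow> z \<in> X \<Longrightarrow> {f x, f y, f z} \<in> {l \<in> L. l \<subseteq> Q} \<longleftrightarrow> {x, y, z} \<in> M"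
    by (rule isomorphic_systemsE[OF _ subsets]) (rule that)
  have "{f x, f y, f z} \<in> L \<longleftrightarrow> {x, y, z} \<in> M" if "x \<in> X" "y \<in> X" "z \<in> X" for x y z
    using bijection(2)[OF that] bij_betwE[OF bijection(1)] that by auto
  then show ?thesis using that bijection(1) by blast
qed

section \<open>Labellings by affine spaces\<close>

lemma two_eq_minus_one: "(2 :: nat \<Rightarrow> 3) = - 1"
  by (rule ext) simp

lemma minus_minus_self: "- u - u = (u :: nat \<Rightarrow> 3)"
  by (simp add: algebra_simps two_eq_minus_one)

lemma affine_points_closed:
  assumes "u \<in> affine_points k" "v \<in> affine_points k"
  shows "- u - v \<in> affine_points k"
  using assms by (simp add: affine_points_def)

lemma zero_in_affine_points: "0 \<in> affine_points k"
  by (simp add: affine_points_def)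

lemma affine_lines_eq:
  "affine_lines k = {{u, v, - u - v} | u v. u \<in> affine_points k \<and> v \<in> affine_points k \<and> u \<noteq> v}"
proof -
  have "(\<lambda>i. - u i - v i) = - u - v" for u v :: "nat \<Rightarrow> 3" by auto
  then show ?thesis unfolding affine_lines_def by simp
qed

lemma affine_lines_subset: "affine_lines k \<subseteq> Pow (affine_points k)"
  unfolding affine_lines_eq using affine_points_closed by blast

context triple_system
begin

text \<open>Only meaningful for equal or collinear points.\<close>

definition star :: "'a \<Rightarrow> 'a \<Rightarrow> 'a" (infixl "\<star>" 75) where
  "p \<star> q = (if p = q then p else third p q)"

lemma star_idem [simp]: "p \<star> p = p"
  by (simp add: star_def)

lemma star_commute: "p \<star> q = q \<star> p"
  by (simp add: star_def third_commute)

lemma star_eq: "{p, q, r} \<in> L \<Longrightarrow> p \<star> q = r"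
  using third_eq line_distinct by (simp add: star_def)

end

locale affine_labelling = triple_system P L for P :: "'a set" and L +
  fixes k :: nat and f :: "(nat \<Rightarrow> 3) \<Rightarrow> 'a"
  assumes label_point: "u \<in> affine_points k \<Longrightarrow> f u \<in> P"
    and label_line: "u \<in> affine_points k \<Longrightarrow> v \<in> affine_points k \<Longrightarrow> u \<noteq> v \<Longrightarrow>
      {f u, f v, f (- u - v)} \<in> L"
begin

lemma label_eq_iff: "u \<in> affine_points k \<Longrightarrow> v \<in> affine_points k \<Longrightarrow> f u = f v \<longleftrightarrow> u = v"
  using label_line[THEN line_distinct(1)] by auto

lemma label_star:
  assumes "u \<in> affine_points k" "v \<in> affine_points k"
  shows "f u \<star> f v = f (- u - v)"
proof (cases "u = v")
  case True
  then show ?thesis by (simp only: star_idem minus_minus_self)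
next
  case False
  then show ?thesis using label_line assms by (simp add: star_eq)
qed

lemma label_third:
  assumes "{f u, f v, r} \<in> L" "u \<in> affine_points k" "v \<in> affine_points k"
  shows "r = f (- u - v)"
  using star_eq[OF assms(1)] label_star[OF assms(2,3)] by simp

lemma labels_subset: "f ` affine_points k \<subseteq> P"
  using label_point by blast

lemma line_closed_labels: "line_closed L (f ` affine_points k)"
  unfolding line_closed_def by (auto dest!: label_third intro: affine_points_closed)

lemma labels_collinear:
  assumes "p \<in> f ` affine_points k" "q \<in> f ` affine_points k" "p \<noteq> q"
  shows "col p q"
  using assms label_line[THEN line_col(1)] by auto

lemma isomorphic_affine:
  assumes "f ` affine_points k = P"
  shows "isomorphic_systems P L (affine_points k) (affine_lines k)"
proof (rule isomorphic_systems_sym[OF _ affine_lines_subset])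
  have "bij_betw f (affine_points k) P"
    unfolding bij_betw_def inj_on_def using assms label_eq_iff by blast
  moreover have "(\<lambda>l. f ` l) ` affine_lines k = L"
  proof (intro equalityI subsetI)
    fix l assume "l \<in> (\<lambda>l. f ` l) ` affine_lines k"
    then show "l \<in> L" unfolding affine_lines_eq using label_line by auto
  next
    fix l assume line: "l \<in> L"
    obtain p q r where line_eq: "l = {p, q, r}" using lineE[OF line] .
    then obtain u v where labels: "u \<in> affine_points k" "v \<in> affine_points k" "p = f u" "q = f v"
      using line_points line assms by (metis imageE)
    then have "l = f ` {u, v, - u - v}" using label_third line line_eq by auto
    moreover have "u \<noteq> v" using labels line_distinct(1) line line_eq by blast
    then have "{u, v, - u - v} \<in> affine_lines k" unfolding affine_lines_eq using labels by blast
    ultimately show "l \<in> (\<lambda>l. f ` l) ` affine_lines k" by blast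
  qed
  ultimately show "isomorphic_systems (affine_points k) (affine_lines k) P L"
    using affine_lines_subset by (intro isomorphic_systemsI)
qed

end

lemma (in triple_system) isomorphic_affineE:
  assumes "isomorphic_systems Q {l \<in> L. l \<subseteq> Q} (affine_points k) (affine_lines k)" "Q \<subseteq> P"
  obtains f where "affine_labelling P L k f" "f ` affine_points k = Q"
proof -
  obtain f where bijection: "bij_betw f (affine_points k) Q"
    "\<And>u v w. u \<in> affine_points k \<Longrightarrow> v \<in> affine_points k \<Longrightarrow> w \<in> affine_points k \<Longrightarrow>
      {f u, f v, f w} \<in> L \<longleftrightarrow> {u, v, w} \<in> affine_lines k"
    using assms(1) affine_lines_subset by (rule isomorphic_subsystemE) (rule that)
  have "affine_labelling P L k f"
  proof unfold_locales
    fix u v assume labels: "u \<in> affine_points k" "v \<in> affine_points k" "u \<noteq> v"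
    then have "{u, v, - u - v} \<in> affine_lines k" unfolding affine_lines_eq by blast
    then show "{f u, f v, f (- u - v)} \<in> L" using bijection(2) labels affine_points_closed by blast
  qed (use bijection(1) assms(2) in \<open>auto simp: bij_betw_def\<close>)
  then show thesis using that bijection(1) by (simp add: bij_betw_def)
qed

section \<open>Labellings by the edges of a complete graph\<close>

lemma doubleton_pair_cases:
  assumes "i \<noteq> j" "k \<noteq> l"
  obtains (equal) "{i, j} = {k, l}" | (disjoint) "distinct [i, j, k, l]"
    | (adjacent) a b c where "distinct [a, b, c]" "{i, j} = {a, b}" "{k, l} = {b, c}"
proof -
  consider (same) "{i, j} = {k, l}" | (all_distinct) "distinct [i, j, k, l]"
    | (ik) "i = k" "j \<noteq> l" | (il) "i = l" "j \<noteq> k" | (jk) "j = k" "i \<noteq> l" | (jl) "j = l" "i \<noteq> k"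
    using assms by (auto simp: doubleton_eq_iff)
  then show thesis
  proof cases
    case ik
    then show ?thesis using assms by (intro adjacent[of j i l]) auto
  next
    case il
    then show ?thesis using assms by (intro adjacent[of j i k]) auto
  next
    case jk
    then show ?thesis using assms by (intro adjacent[of i j l]) auto
  next
    case jl
    then show ?thesis using assms by (intro adjacent[of i j k]) auto
  qed (use equal disjoint in auto)
qed

definition edge_points :: "'v set \<Rightarrow> ('v \<Rightarrow> 'v \<Rightarrow> 'a) \<Rightarrow> 'a set" where
  "edge_points V g = {g i j | i j. i \<in> V \<and> j \<in> V \<and> i \<noteq> j}"

lemma edge_pointsI: "i \<in> V \<Longrightarrow> j \<in> V \<Longrightarrow> i \<noteq> j \<Longrightarrow> g i j \<in> edge_points V g"
  unfolding edge_points_def by blast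

lemma edge_pointsE:
  assumes "p \<in> edge_points V g"
  obtains i j where "i \<in> V" "j \<in> V" "i \<noteq> j" "p = g i j"
  using assms unfolding edge_points_def by blast

text \<open>The point \<open>g i j\<close> belongs to the edge \<open>ij\<close>; the values \<open>g i i\<close> are irrelevant.\<close>

locale edge_labelling = triple_system P L for P :: "'a set" and L +
  fixes V :: "'v set" and g :: "'v \<Rightarrow> 'v \<Rightarrow> 'a"
  assumes edge_commute: "g i j = g j i"
    and edge_in_points: "i \<in> V \<Longrightarrow> j \<in> V \<Longrightarrow> i \<noteq> j \<Longrightarrow> g i j \<in> P"
    and triangle_line: "{i, j, k} \<subseteq> V \<Longrightarrow> distinct [i, j, k] \<Longrightarrow> {g i j, g j k, g i k} \<in> L"
    and disjoint_edges: "{i, j, k, l} \<subseteq> V \<Longrightarrow> distinct [i, j, k, l] \<Longrightarrow>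
      g i j \<noteq> g k l \<and> \<not> col (g i j) (g k l)"
begin

lemma edge_cong: "{i, j} = {k, l} \<Longrightarrow> g i j = g k l"
  using edge_commute by (auto simp: doubleton_eq_iff)

lemma edge_pair_cases [consumes 2]:
  assumes "p \<in> edge_points V g" "q \<in> edge_points V g"
  obtains (equal) "p = q"
    | (disjoint) i j k l where "{i, j, k, l} \<subseteq> V" "distinct [i, j, k, l]" "p = g i j" "q = g k l"
    | (adjacent) i j k where "{i, j, k} \<subseteq> V" "distinct [i, j, k]" "p = g i j" "q = g j k"
proof -
  obtain i j where p_edge: "i \<in> V" "j \<in> V" "i \<noteq> j" "p = g i j" using edge_pointsE[OF assms(1)] .
  obtain k l where q_edge: "k \<in> V" "l \<in> V" "k \<noteq> l" "q = g k l" using edge_pointsE[OF assms(2)] .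
  show thesis
  proof (rule doubleton_pair_cases[OF p_edge(3) q_edge(3)])
    assume "{i, j} = {k, l}"
    then show thesis using edge_cong[of i j k l] p_edge q_edge by (intro equal) simp
  next
    assume "distinct [i, j, k, l]"
    then show thesis using p_edge q_edge by (intro disjoint) auto
  next
    fix a b c assume shared: "distinct [a, b, c]" "{i, j} = {a, b}" "{k, l} = {b, c}"
    have "{a, b, c} = {i, j} \<union> {k, l}" unfolding shared(2,3) by blast
    then show thesis
      using shared p_edge q_edge edge_cong[OF shared(2)] edge_cong[OF shared(3)]
      by (intro adjacent[of a b c]) auto
  qed
qed

lemma edge_eq_iff:
  assumes "{i, j, k, l} \<subseteq> V" "i \<noteq> j" "k \<noteq> l"
  shows "g i j = g k l \<longleftrightarrow> {i, j} = {k, l}"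
proof
  assume equal_points: "g i j = g k l"
  show "{i, j} = {k, l}"
  proof (rule doubleton_pair_cases[OF assms(2,3)])
    assume "distinct [i, j, k, l]"
    then show ?thesis using disjoint_edges assms(1) equal_points by blast
  next
    fix a b c assume shared: "distinct [a, b, c]" "{i, j} = {a, b}" "{k, l} = {b, c}"
    have "{a, b, c} = {i, j} \<union> {k, l}" unfolding shared(2,3) by blast
    then have "g a b \<noteq> g b c" using line_distinct(1) triangle_line[of a b c] shared(1) assms(1) by blast
    then show ?thesis using edge_cong shared(2,3) equal_points by metis
  qed
qed (rule edge_cong)

lemma line_through_edgesE:
  assumes "{p, q, r} \<in> L" "p \<in> edge_points V g" "q \<in> edge_points V g"
  obtains i j k where "{i, j, k} \<subseteq> V" "distinct [i, j, k]" "p = g i j" "q = g j k" "r = g i k"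
  using assms(2,3)
proof (cases rule: edge_pair_cases)
  case equal
  then show ?thesis using line_distinct(1)[OF assms(1)] by simp
next
  case (disjoint i j k l)
  then show ?thesis using disjoint_edges[of i j k l] line_col(1)[OF assms(1)] by simp
next
  case (adjacent i j k)
  then show ?thesis using that triangle_line[of i j k] line_unique[of p q r] assms(1) by metis
qed

lemma line_closed_edge_points: "line_closed L (edge_points V g)"
  unfolding line_closed_def
proof (intro allI impI)
  fix p q r assume "{p, q, r} \<in> L" "p \<in> edge_points V g" "q \<in> edge_points V g"
  then obtain i j k where "{i, j, k} \<subseteq> V" "distinct [i, j, k]" "r = g i k"
    by (rule line_through_edgesE)
  then show "r \<in> edge_points V g" by (simp add: edge_pointsI)
qed

lemma symmetric_function_on_edges:
  assumes "\<And>i j. F i j = F j i"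
  obtains \<phi> where "\<And>i j. i \<in> V \<Longrightarrow> j \<in> V \<Longrightarrow> i \<noteq> j \<Longrightarrow> \<phi> (g i j) = F i j"
proof
  define \<phi> where "\<phi> p = (SOME x. \<exists>k l. k \<in> V \<and> l \<in> V \<and> k \<noteq> l \<and> p = g k l \<and> x = F k l)" for p
  fix i j assume edge: "i \<in> V" "j \<in> V" "i \<noteq> j"
  have unique: "F k l = F i j" if "k \<in> V" "l \<in> V" "k \<noteq> l" "g i j = g k l" for k l
    using edge_eq_iff[of i j k l] that edge assms[of i j] by (auto simp: doubleton_eq_iff)
  show "\<phi> (g i j) = F i j"
    unfolding \<phi>_def
  proof (rule some_equality)
    fix x assume "\<exists>k l. k \<in> V \<and> l \<in> V \<and> k \<noteq> l \<and> g i j = g k l \<and> x = F k l"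
    then show "x = F i j" using unique by metis
  qed (use edge in blast)
qed

end

lemma (in edge_labelling) isomorphic_edge_system:
  assumes "edge_points V g = P" and commute: "\<And>i j. e i j = e j i"
    and eq_iff: "\<And>i j k l. i \<noteq> j \<Longrightarrow> k \<noteq> l \<Longrightarrow> e i j = e k l \<longleftrightarrow> {i, j} = {k, l}"
  shows "isomorphic_systems P L (edge_points V e)
    {{e i j, e j k, e i k} | i j k. {i, j, k} \<subseteq> V \<and> distinct [i, j, k]}" (is "isomorphic_systems P L _ ?M")
proof -
  obtain h where h_edge: "\<And>i j. i \<in> V \<Longrightarrow> j \<in> V \<Longrightarrow> i \<noteq> j \<Longrightarrow> h (g i j) = e i j"
    using commute by (rule symmetric_function_on_edges) (rule that)
  have "inj_on h P"
  proof (rule inj_onI)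
    fix p q assume "p \<in> P" "q \<in> P" and equal_images: "h p = h q"
    then have "p \<in> edge_points V g" "q \<in> edge_points V g" using assms(1) by simp_all
    then obtain i j k l where vertices: "i \<in> V" "j \<in> V" "i \<noteq> j" "k \<in> V" "l \<in> V" "k \<noteq> l"
      and edges: "p = g i j" "q = g k l"
      by (elim edge_pointsE)
    then have "{i, j} = {k, l}" using equal_images h_edge by (simp add: eq_iff)
    then show "p = q" unfolding edges by (rule edge_cong)
  qed
  moreover have "h ` edge_points V g = edge_points V e"
    unfolding edge_points_def using h_edge by (auto simp: image_iff) metis+
  moreover have "(\<lambda>l. h ` l) ` L = ?M"
  proof (intro equalityI subsetI)
    fix X assume "X \<in> (\<lambda>l. h ` l) ` L"
    then obtain l where line: "l \<in> L" "X = h ` l" by blast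
    obtain p q r where line_eq: "l = {p, q, r}" using lineE[OF line(1)] .
    then obtain i j k where vertices: "{i, j, k} \<subseteq> V" "distinct [i, j, k]"
      and "p = g i j" "q = g j k" "r = g i k"
      using line_through_edgesE[of p q r] line_points[of p q r] line(1) assms(1) by metis
    then have "X = {e i j, e j k, e i k}" using h_edge line(2) line_eq by simp
    then show "X \<in> ?M" using vertices by blast
  next
    fix X assume "X \<in> ?M"
    then obtain i j k where vertices: "{i, j, k} \<subseteq> V" "distinct [i, j, k]"
      and triangle: "X = {e i j, e j k, e i k}"
      by blast
    have "X = h ` {g i j, g j k, g i k}" using triangle vertices h_edge by simp
    then show "X \<in> (\<lambda>l. h ` l) ` L" using triangle_line[OF vertices] by blast
  qed
  moreover have "L \<subseteq> Pow P" using line_subset by blast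
  ultimately show ?thesis
    using assms(1) by (intro isomorphic_systemsI[of h]) (simp_all add: bij_betw_def)
qed

lemma (in triple_system) edge_labelling_of_isomorphism:
  assumes isomorphic: "isomorphic_systems Q {l \<in> L. l \<subseteq> Q} X M" and subsets: "M \<subseteq> Pow X"
    and closed: "line_closed L Q" "Q \<subseteq> P"
    and commute: "\<And>i j. e i j = e j i" and points: "edge_points V e = X"
    and triangle: "\<And>i j k. {i, j, k} \<subseteq> V \<Longrightarrow> distinct [i, j, k] \<Longrightarrow> {e i j, e j k, e i k} \<in> M"
    and disjoint: "\<And>i j k l x. {i, j, k, l} \<subseteq> V \<Longrightarrow> distinct [i, j, k, l] \<Longrightarrow>
      e i j \<noteq> e k l \<and> {e i j, e k l, x} \<notin> M"
  obtains g where "edge_labelling P L V g" "edge_points V g = Q"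
proof -
  obtain f where bijection: "bij_betw f X Q"
    and line_iff: "\<And>x y z. x \<in> X \<Longrightarrow> y \<in> X \<Longrightarrow> z \<in> X \<Longrightarrow> {f x, f y, f z} \<in> L \<longleftrightarrow> {x, y, z} \<in> M"
    using isomorphic subsets by (rule isomorphic_subsystemE) (rule that)
  have injective: "inj_on f X" and image: "f ` X = Q" using bijection by (auto simp: bij_betw_def)
  have edge: "e i j \<in> X" if "i \<in> V" "j \<in> V" "i \<noteq> j" for i j
    using edge_pointsI[OF that, of e] unfolding points .
  define g where "g i j = f (e i j)" for i j
  have "edge_labelling P L V g"
  proof unfold_locales
    show "g i j = g j i" for i j unfolding g_def by (simp only: commute)
    show "g i j \<in> P" if "i \<in> V" "j \<in> V" "i \<noteq> j" for i j
      using edge[OF that] image closed(2) unfolding g_def by blast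
    show "{g i j, g j k, g i k} \<in> L" if "{i, j, k} \<subseteq> V" "distinct [i, j, k]" for i j k
      using triangle[OF that] that edge line_iff unfolding g_def by simp
  next
    fix i j k l assume vertices: "{i, j, k, l} \<subseteq> V" "distinct [i, j, k, l]"
    then have ij_point: "e i j \<in> X" and kl_point: "e k l \<in> X" using edge by auto
    have "\<not> col (g i j) (g k l)"
    proof
      assume "col (g i j) (g k l)"
      then obtain r where collinear_line: "{g i j, g k l, r} \<in> L" unfolding col_iff by blast
      then have "r \<in> Q"
        using line_closedD[OF closed(1) collinear_line] ij_point kl_point image unfolding g_def by blast
      then obtain x where "x \<in> X" "r = f x" using image by blast
      then show False using collinear_line line_iff[OF ij_point kl_point] disjoint[OF vertices] unfolding g_def by simp
    qed
    then show "g i j \<noteq> g k l \<and> \<not> col (g i j) (g k l)"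
      unfolding g_def using inj_on_eq_iff[OF injective ij_point kl_point] disjoint[OF vertices] by simp
  qed
  moreover have "edge_points V g = f ` edge_points V e"
    unfolding edge_points_def g_def by blast
  ultimately show thesis using that image points by simp
qed

section \<open>The Fischer space of the symmetric group\<close>

lemma transpose_eq_iff_doubleton:
  assumes "i \<noteq> j" "k \<noteq> l"
  shows "transpose i j = transpose k l \<longleftrightarrow> {i, j} = {k, l}"
proof
  assume equal: "transpose i j = transpose k l"
  have "transpose k l i \<noteq> i" "transpose k l j \<noteq> j" unfolding equal[symmetric] using assms(1) by auto
  then have "i \<in> {k, l}" "j \<in> {k, l}" by (auto simp: transpose_def split: if_splits)
  then show "{i, j} = {k, l}" using assms by auto
next
  assume "{i, j} = {k, l}"
  then show "transpose i j = transpose k l" by (auto simp: doubleton_eq_iff transpose_commute)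
qed

lemma (in group) ord_eq_prime:
  assumes "x \<in> carrier G" "prime p" "x [^] p = \<one>" "x \<noteq> \<one>"
  shows "ord x = p"
proof -
  have "ord x dvd p" using assms pow_eq_id by blast
  then have "ord x = 1 \<or> ord x = p" using \<open>prime p\<close> by (simp add: prime_nat_iff)
  then show ?thesis using assms ord_eq_1 by blast
qed

lemma transpose_in_transpositions:
  "i \<in> {1..m} \<Longrightarrow> j \<in> {1..m} \<Longrightarrow> i \<noteq> j \<Longrightarrow> transpose i j \<in> transpositions m"
  unfolding transpositions_def by blast

lemma transpose_in_sym_group: "i \<in> {1..m} \<Longrightarrow> j \<in> {1..m} \<Longrightarrow> transpose i j \<in> carrier (sym_group m)"
  by (simp add: sym_group_carrier permutes_swap_id)

lemma transpose_conjugate: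
  assumes "distinct [i, j, k]"
  shows "transpose j k \<circ> transpose i j \<circ> transpose j k = transpose i k"
  using transpose_comp_triple[of k i j] assms by (metis distinct_length_2_or_more transpose_commute)

lemma sym_group_inv_transpose:
  assumes "i \<in> {1..m}" "j \<in> {1..m}"
  shows "inv\<^bsub>sym_group m\<^esub> (transpose i j) = transpose i j"
proof -
  interpret group "sym_group m" by (rule sym_group_is_group)
  show ?thesis using transpose_in_sym_group[OF assms]
    by (intro inv_equality) (auto simp: sym_group_mult sym_group_one)
qed

lemma ord_adjacent_transpositions:
  assumes "{i, j, k} \<subseteq> {1..m}" "distinct [i, j, k]"
  shows "group.ord (sym_group m) (transpose i j \<circ> transpose j k) = 3"
proof -
  interpret group "sym_group m" by (rule sym_group_is_group)
  let ?x = "transpose i j \<circ> transpose j k"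
  have in_carrier: "?x \<in> carrier (sym_group m)"
    using m_closed[of "transpose i j" "transpose j k"] assms
    by (simp add: transpose_in_sym_group sym_group_mult)
  have "?x [^]\<^bsub>sym_group m\<^esub> (3::nat) = ?x \<circ> ?x \<circ> ?x"
    using in_carrier by (simp add: numeral_3_eq_3 sym_group_mult sym_group_one)
  also have "\<dots> =
      transpose i j \<circ> (transpose j k \<circ> transpose i j \<circ> transpose j k) \<circ> transpose i j \<circ> transpose j k"
    by (simp add: comp_assoc)
  also have "\<dots> = (transpose i j \<circ> transpose k i \<circ> transpose i j) \<circ> transpose j k"
    using transpose_conjugate[OF assms(2)] by (simp add: comp_assoc transpose_commute[of k i])
  also have "\<dots> = transpose k j \<circ> transpose j k"
    using transpose_conjugate[of k i j] assms(2) by simp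
  also have "\<dots> = id" by (simp add: transpose_commute[of k j])
  finally have "?x [^]\<^bsub>sym_group m\<^esub> (3::nat) = \<one>\<^bsub>sym_group m\<^esub>" by (simp add: sym_group_one)
  moreover have "?x k \<noteq> id k" using assms(2) by (simp add: transpose_def)
  then have "?x \<noteq> \<one>\<^bsub>sym_group m\<^esub>" unfolding sym_group_one by metis
  ultimately show ?thesis using in_carrier by (intro ord_eq_prime) auto
qed

lemma ord_disjoint_transpositions:
  assumes "{i, j, k, l} \<subseteq> {1..m}" "distinct [i, j, k, l]"
  shows "group.ord (sym_group m) (transpose i j \<circ> transpose k l) = 2"
proof -
  interpret group "sym_group m" by (rule sym_group_is_group)
  let ?x = "transpose i j \<circ> transpose k l"
  have in_carrier: "?x \<in> carrier (sym_group m)"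
    using m_closed[of "transpose i j" "transpose k l"] assms
    by (simp add: transpose_in_sym_group sym_group_mult)
  have "(?x \<circ> ?x) z = z" for z using assms(2) by (auto simp: transpose_def)
  then have "?x \<circ> ?x = id" by (simp add: fun_eq_iff)
  then have "?x [^]\<^bsub>sym_group m\<^esub> (2::nat) = \<one>\<^bsub>sym_group m\<^esub>"
    using in_carrier by (simp add: numeral_2_eq_2 sym_group_mult sym_group_one)
  moreover have "?x i \<noteq> id i" using assms(2) by (simp add: transpose_def)
  then have "?x \<noteq> \<one>\<^bsub>sym_group m\<^esub>" unfolding sym_group_one by metis
  ultimately show ?thesis using in_carrier by (intro ord_eq_prime) auto
qed

lemma transpositions_ord_3E:
  assumes "c \<in> transpositions m" "d \<in> transpositions m" "group.ord (sym_group m) (c \<circ> d) = 3"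
  obtains i j k where "{i, j, k} \<subseteq> {1..m}" "distinct [i, j, k]" "c = transpose i j" "d = transpose j k"
proof -
  interpret group "sym_group m" by (rule sym_group_is_group)
  obtain i j where c_eq: "i \<in> {1..m}" "j \<in> {1..m}" "i \<noteq> j" "c = transpose i j"
    using assms(1) unfolding transpositions_def by auto
  obtain k l where d_eq: "k \<in> {1..m}" "l \<in> {1..m}" "k \<noteq> l" "d = transpose k l"
    using assms(2) unfolding transpositions_def by auto
  show thesis
  proof (rule doubleton_pair_cases[OF c_eq(3) d_eq(3)])
    assume "{i, j} = {k, l}"
    then have "c \<circ> d = \<one>\<^bsub>sym_group m\<^esub>"
      unfolding c_eq(4) d_eq(4) by (auto simp: doubleton_eq_iff transpose_commute sym_group_one)
    then show thesis using assms(3) ord_eq_1[OF one_closed] by simp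
  next
    assume "distinct [i, j, k, l]"
    then show thesis using assms(3) ord_disjoint_transpositions[of i j k l m] c_eq d_eq by simp
  next
    fix x y z assume shared: "distinct [x, y, z]" "{i, j} = {x, y}" "{k, l} = {y, z}"
    have "{x, y, z} = {i, j} \<union> {k, l}" unfolding shared(2,3) by blast
    then have "{x, y, z} \<subseteq> {1..m}" using c_eq d_eq by simp
    moreover have "c = transpose x y" "d = transpose y z"
      using c_eq d_eq shared transpose_eq_iff_doubleton[of i j x y] transpose_eq_iff_doubleton[of k l y z] by auto
    ultimately show thesis using that shared(1) by blast
  qed
qed

lemma fischer_lines_transpositions:
  "fischer_lines (sym_group m) (transpositions m) =
    {{transpose i j, transpose j k, transpose i k} | i j k. {i, j, k} \<subseteq> {1..m} \<and> distinct [i, j, k]}"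
    (is "_ = ?triangles")
proof (intro equalityI subsetI)
  fix X assume "X \<in> fischer_lines (sym_group m) (transpositions m)"
  then obtain c d where transpositions: "c \<in> transpositions m" "d \<in> transpositions m"
      "group.ord (sym_group m) (c \<circ> d) = 3"
    and X_eq: "X = {c, d, inv\<^bsub>sym_group m\<^esub> d \<circ> c \<circ> d}"
    unfolding fischer_lines_def by (auto simp: sym_group_mult)
  obtain i j k where vertices: "{i, j, k} \<subseteq> {1..m}" "distinct [i, j, k]"
    and "c = transpose i j" "d = transpose j k"
    using transpositions by (rule transpositions_ord_3E)
  then have "X = {transpose i j, transpose j k, transpose i k}"
    using X_eq transpose_conjugate[of i j k] by (simp add: sym_group_inv_transpose)
  then show "X \<in> ?triangles" using vertices by blast
next
  fix X assume "X \<in> ?triangles"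
  then obtain i j k where vertices: "{i, j, k} \<subseteq> {1..m}" "distinct [i, j, k]"
    and X_eq: "X = {transpose i j, transpose j k, transpose i k}" by blast
  have "X = {transpose i j, transpose j k, inv\<^bsub>sym_group m\<^esub> (transpose j k) \<circ> transpose i j \<circ> transpose j k}"
    using X_eq vertices transpose_conjugate[OF vertices(2)] by (simp add: sym_group_inv_transpose)
  moreover have "transpose i j \<in> transpositions m" "transpose j k \<in> transpositions m"
    using vertices by (simp_all add: transpose_in_transpositions)
  ultimately show "X \<in> fischer_lines (sym_group m) (transpositions m)"
    unfolding fischer_lines_def sym_group_mult using ord_adjacent_transpositions[OF vertices] by blast
qed

lemma fischer_lines_transpositions_subset:
  "fischer_lines (sym_group m) (transpositions m) \<subseteq> Pow (transpositions m)"
proof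
  fix X assume "X \<in> fischer_lines (sym_group m) (transpositions m)"
  then obtain i j k where vertices: "{i, j, k} \<subseteq> {1..m}" "distinct [i, j, k]"
    and X_eq: "X = {transpose i j, transpose j k, transpose i k}"
    unfolding fischer_lines_transpositions by blast
  show "X \<in> Pow (transpositions m)" unfolding X_eq using vertices by (simp add: transpose_in_transpositions)
qed

lemma no_line_through_disjoint_transpositions:
  assumes "distinct [i, j, k, l]"
  shows "{transpose i j, transpose k l, \<rho>} \<notin> fischer_lines (sym_group m) (transpositions m)"
proof
  assume "{transpose i j, transpose k l, \<rho>} \<in> fischer_lines (sym_group m) (transpositions m)"
  then obtain a b c where triangle: "distinct [a, b, c]"
    "{transpose i j, transpose k l, \<rho>} = {transpose a b, transpose b c, transpose a c}"
    unfolding fischer_lines_transpositions by blast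
  have "{x, y} \<subseteq> {a, b, c}" if "x \<noteq> y" "transpose x y \<in> {transpose a b, transpose b c, transpose a c}" for x y
    using that triangle(1) by (auto simp: transpose_eq_iff_doubleton doubleton_eq_iff)
  then have "{i, j} \<subseteq> {a, b, c}" "{k, l} \<subseteq> {a, b, c}" using assms triangle(2) by auto
  then have "{i, j, k, l} \<subseteq> {a, b, c}" by blast
  then have "card {i, j, k, l} \<le> card {a, b, c}" by (intro card_mono) auto
  then show False using assms triangle(1) by simp
qed

lemma (in triple_system) isomorphic_transpositionsE:
  assumes "isomorphic_systems P L (transpositions m) (fischer_lines (sym_group m) (transpositions m))"
  obtains g where "edge_labelling P L {1..m} g" "edge_points {1..m} g = P"
proof (rule edge_labelling_of_isomorphism[OF _ fischer_lines_transpositions_subset line_closed_points])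
  show "isomorphic_systems P {l \<in> L. l \<subseteq> P} (transpositions m)
      (fischer_lines (sym_group m) (transpositions m))"
    using assms by (simp add: lines_within_points)
  show "edge_points {1..m} transpose = transpositions m"
    unfolding edge_points_def transpositions_def ..
  show "{transpose i j, transpose j k, transpose i k} \<in> fischer_lines (sym_group m) (transpositions m)"
    if "{i, j, k} \<subseteq> {1..m}" "distinct [i, j, k]" for i j k
    using that unfolding fischer_lines_transpositions by blast
  show "transpose i j \<noteq> transpose k l \<and>
      {transpose i j, transpose k l, \<sigma>} \<notin> fischer_lines (sym_group m) (transpositions m)"
    if "{i, j, k, l} \<subseteq> {1..m}" "distinct [i, j, k, l]" for i j k l \<sigma>
    using that no_line_through_disjoint_transpositions by (auto simp: transpose_eq_iff_doubleton doubleton_eq_iff)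
qed (use that transpose_commute in auto)

lemma edge_labelling_isomorphic_transpositions:
  assumes "edge_labelling P L {1..m} g" "edge_points {1..m} g = P"
  shows "isomorphic_systems P L (transpositions m) (fischer_lines (sym_group m) (transpositions m))"
proof -
  interpret edge_labelling P L "{1..m}" g by fact
  have "edge_points {1..m} transpose = transpositions m"
    unfolding edge_points_def transpositions_def ..
  then show ?thesis
    using isomorphic_edge_system[OF assms(2), of transpose] transpose_eq_iff_doubleton transpose_commute
    unfolding fischer_lines_transpositions by metis
qed

section \<open>Matsuo algebras\<close>

lemma lookup_pm_scale [simp]: "Poly_Mapping.lookup (pm_scale c x) k = c * Poly_Mapping.lookup x k"
  unfolding pm_scale_def by (simp add: map.rep_eq when_def)

lemma lookup_axis: "Poly_Mapping.lookup (axis p) q = of_bool (p = q)"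
  unfolding axis_def by (simp add: lookup_single when_def)

interpretation pm: vector_space "pm_scale :: 'f::field \<Rightarrow> ('a \<Rightarrow>\<^sub>0 'f) \<Rightarrow> 'a \<Rightarrow>\<^sub>0 'f"
  by unfold_locales (auto intro!: poly_mapping_eqI simp: lookup_add algebra_simps)

definition linear_extension ::
    "('f::field \<Rightarrow> 'v::ab_group_add \<Rightarrow> 'v) \<Rightarrow> ('a \<Rightarrow> 'v) \<Rightarrow> ('a \<Rightarrow>\<^sub>0 'f) \<Rightarrow> 'v" where
  "linear_extension sc \<phi> x = (\<Sum>p\<in>Poly_Mapping.keys x. sc (Poly_Mapping.lookup x p) (\<phi> p))"

lemma axis_expansion: "linear_extension pm_scale axis x = x"
  by (rule poly_mapping_eqI)
    (simp add: linear_extension_def lookup_sum lookup_axis of_bool_def if_distrib[of "\<lambda>u. _ * u"]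
      not_in_keys_iff_lookup_eq_zero cong: if_cong)

lemma (in vector_space) linear_extension_superset:
  assumes "finite A" "Poly_Mapping.keys x \<subseteq> A"
  shows "linear_extension scale \<phi> x = (\<Sum>p\<in>A. scale (Poly_Mapping.lookup x p) (\<phi> p))"
  unfolding linear_extension_def using assms
  by (intro sum.mono_neutral_left) (auto simp: not_in_keys_iff_lookup_eq_zero)

lemma (in vector_space) module_hom_linear_extension:
  fixes \<phi> :: "'p \<Rightarrow> 'b"
  shows "module_hom pm_scale scale (linear_extension scale \<phi>)"
proof unfold_locales
  fix x y :: "'p \<Rightarrow>\<^sub>0 'a"
  let ?A = "Poly_Mapping.keys x \<union> Poly_Mapping.keys y"
  show "linear_extension scale \<phi> (x + y) = linear_extension scale \<phi> x + linear_extension scale \<phi> y"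
    using keys_add[of x y]
    by (subst (1 2 3) linear_extension_superset[where A = ?A])
      (auto simp: lookup_add scale_left_distrib sum.distrib)
next
  fix c and x :: "'p \<Rightarrow>\<^sub>0 'a"
  have "Poly_Mapping.keys (pm_scale c x) \<subseteq> Poly_Mapping.keys x" by (auto simp: in_keys_iff)
  then show "linear_extension scale \<phi> (pm_scale c x) = scale c (linear_extension scale \<phi> x)"
    by (subst linear_extension_superset[where A = "Poly_Mapping.keys x"])
      (auto simp: linear_extension_def scale_sum_right)
qed

lemma (in vector_space) linear_extension_axis: "linear_extension scale \<phi> (axis p) = \<phi> p"
  by (simp add: linear_extension_def axis_def)

lemma subspace_matsuo_carrier: "pm.subspace (matsuo_carrier P)"
proof (rule pm.subspaceI)
  show "x + y \<in> matsuo_carrier P" if "x \<in> matsuo_carrier P" "y \<in> matsuo_carrier P" for x y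
    using that keys_add[of x y] unfolding matsuo_carrier_def by blast
  show "pm_scale c x \<in> matsuo_carrier P" if "x \<in> matsuo_carrier P" for c x
    using that by (auto simp: matsuo_carrier_def in_keys_iff)
qed (simp add: matsuo_carrier_def)

lemma axis_in_carrier: "p \<in> P \<Longrightarrow> axis p \<in> matsuo_carrier P"
  by (simp add: axis_def matsuo_carrier_def)

lemma matsuo_carrier_eq_span: "matsuo_carrier P = pm.span (axis ` P)"
proof (rule pm.span_subspace[symmetric])
  show "matsuo_carrier P \<subseteq> pm.span (axis ` P)"
  proof
    fix x assume "x \<in> matsuo_carrier P"
    then have "linear_extension pm_scale axis x \<in> pm.span (axis ` P)"
      unfolding linear_extension_def matsuo_carrier_def
      by (intro pm.span_sum pm.span_scale pm.span_base) auto
    then show "x \<in> pm.span (axis ` P)" unfolding axis_expansion .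
  qed
qed (auto intro: axis_in_carrier subspace_matsuo_carrier)

lemma matsuo_carrier_induct [consumes 1, case_names zero add]:
  assumes "x \<in> matsuo_carrier P" and "R 0"
    and "\<And>c p y. p \<in> P \<Longrightarrow> y \<in> matsuo_carrier P \<Longrightarrow> R y \<Longrightarrow> R (pm_scale c (axis p) + y)"
  shows "R x"
proof -
  have "x \<in> matsuo_carrier P \<and> R x"
    using assms(1) unfolding matsuo_carrier_eq_span
  proof (induction rule: pm.span_induct_alt)
    case (step c a y)
    then obtain p where "p \<in> P" "a = axis p" by blast
    moreover have "pm_scale c a + y \<in> pm.span (axis ` P)"
      using step by (simp add: pm.span_add pm.span_scale pm.span_base)
    ultimately show ?case using assms(3)[of p y c] step(2) by (simp add: matsuo_carrier_eq_span)
  qed (use assms(2) pm.span_zero in blast)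
  then show ?thesis ..
qed

lemma matsuo_mult_eq_linear_extension:
  "matsuo_mult L \<delta> x y =
    linear_extension pm_scale (\<lambda>p. linear_extension pm_scale (axis_mult L \<delta> p) y) x"
  by (simp add: matsuo_mult_def linear_extension_def pm.scale_sum_right)

lemma module_hom_matsuo_mult_left: "module_hom pm_scale pm_scale (\<lambda>x. matsuo_mult L \<delta> x y)"
  unfolding matsuo_mult_eq_linear_extension by (rule pm.module_hom_linear_extension)

lemma matsuo_mult_commute: "matsuo_mult L \<delta> x y = matsuo_mult L \<delta> y x"
proof -
  have "axis_mult L \<delta> p q = axis_mult L \<delta> q p" for p q
    by (auto simp: axis_mult_def collinear_def third_point_def insert_commute add.commute conj_commute)
  then show ?thesis unfolding matsuo_mult_def by (subst sum.swap) (simp add: mult.commute)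
qed

lemma module_hom_matsuo_mult_right: "module_hom pm_scale pm_scale (\<lambda>y. matsuo_mult L \<delta> x y)"
  using module_hom_matsuo_mult_left[of L \<delta> x] by (simp only: matsuo_mult_commute)

lemmas matsuo_mult_bilinear =
  module_hom_matsuo_mult_left[THEN module_hom.add] module_hom_matsuo_mult_right[THEN module_hom.add]
  module_hom_matsuo_mult_left[THEN module_hom.diff] module_hom_matsuo_mult_right[THEN module_hom.diff]
  module_hom_matsuo_mult_left[THEN module_hom.scale] module_hom_matsuo_mult_right[THEN module_hom.scale]
  module_hom_matsuo_mult_left[THEN module_hom.zero] module_hom_matsuo_mult_right[THEN module_hom.zero]

lemma matsuo_mult_axis: "matsuo_mult L \<delta> (axis p) (axis q) = axis_mult L \<delta> p q"
  by (simp add: matsuo_mult_eq_linear_extension pm.linear_extension_axis)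

context triple_system
begin

lemma axis_mult_in_carrier:
  assumes "p \<in> P" "q \<in> P"
  shows "axis_mult L \<delta> p q \<in> matsuo_carrier P"
proof -
  have "col p q \<Longrightarrow> third p q \<in> P" using third_line line_points(3) by blast
  then show ?thesis
    unfolding axis_mult_def using assms subspace_matsuo_carrier
    by (auto intro!: pm.subspace_scale pm.subspace_diff pm.subspace_add pm.subspace_0 axis_in_carrier)
qed

lemma axis_mult_line:
  assumes "{p, q, r} \<in> L"
  shows "axis_mult L \<delta> p q = pm_scale \<delta> (axis p + axis q - axis r)"
  using assms line_distinct(1) line_col(1) third_eq by (simp add: axis_mult_def)

lemma algebra_on_matsuo: "algebra_on pm_scale (matsuo_carrier P) (matsuo_mult L \<delta>)"
proof -
  have "matsuo_mult L \<delta> x y \<in> matsuo_carrier P"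
    if "x \<in> matsuo_carrier P" "y \<in> matsuo_carrier P" for x y
    unfolding matsuo_mult_def using that subspace_matsuo_carrier
    by (intro pm.subspace_sum pm.subspace_scale axis_mult_in_carrier) (auto simp: matsuo_carrier_def)
  then show ?thesis
    by (simp add: algebra_on_def matsuo_mult_bilinear pm.vector_space_axioms subspace_matsuo_carrier)
qed

end

section \<open>Embedding Matsuo algebras into Jordan algebras\<close>

lemma jordan_algebra_embedding:
  assumes "algebra_on sc A mul" and "jordan_algebra sc' B mul'"
    and "inj_on F A" and "\<And>x. x \<in> A \<Longrightarrow> F x \<in> B"
    and "\<And>x y. x \<in> A \<Longrightarrow> y \<in> A \<Longrightarrow> F (mul x y) = mul' (F x) (F y)"
  shows "jordan_algebra sc A mul"
proof -
  have closed: "mul x y \<in> A" if "x \<in> A" "y \<in> A" for x y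
    using assms(1) that unfolding algebra_on_def by blast
  have commute: "F (mul x y) = F (mul y x)" if "x \<in> A" "y \<in> A" for x y
    using assms(2,4,5) that unfolding jordan_algebra_def by metis
  have identity: "F (mul (mul (mul x x) y) x) = F (mul (mul x x) (mul y x))" if "x \<in> A" "y \<in> A" for x y
    using assms(2,4) that unfolding jordan_algebra_def by (simp add: assms(5) closed)
  show ?thesis
    unfolding jordan_algebra_def
    using assms(1) closed commute[THEN inj_onD[OF assms(3)]] identity[THEN inj_onD[OF assms(3)]] by simp
qed

lemma (in vector_space) inj_on_linear_extension:
  assumes dual: "\<And>p. p \<in> P \<Longrightarrow> \<exists>c. module_hom scale (*) c \<and> (\<forall>q\<in>P. c (\<phi> q) = of_bool (q = p))"
  shows "inj_on (linear_extension scale \<phi>) (matsuo_carrier P)"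
proof (rule inj_onI)
  fix x y assume in_carrier: "x \<in> matsuo_carrier P" "y \<in> matsuo_carrier P"
    and equal_images: "linear_extension scale \<phi> x = linear_extension scale \<phi> y"
  show "x = y"
  proof (rule poly_mapping_eqI)
    fix p
    show "Poly_Mapping.lookup x p = Poly_Mapping.lookup y p"
    proof (cases "p \<in> P")
      case True
      then obtain c where functional: "module_hom scale (*) c" "\<And>q. q \<in> P \<Longrightarrow> c (\<phi> q) = of_bool (q = p)"
        using dual by blast
      interpret functional: module_hom scale "(*)" c by fact
      have "c (linear_extension scale \<phi> z) = Poly_Mapping.lookup z p" if "z \<in> matsuo_carrier P" for z
      proof -
        have "c (linear_extension scale \<phi> z) =
            (\<Sum>q\<in>Poly_Mapping.keys z. if p = q then Poly_Mapping.lookup z q else 0)"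
          unfolding linear_extension_def functional.sum functional.scale
          using that functional(2) by (intro sum.cong) (auto simp: matsuo_carrier_def)
        then show ?thesis by (simp add: not_in_keys_iff_lookup_eq_zero)
      qed
      then show ?thesis using in_carrier equal_images by metis
    next
      case False
      then have "p \<notin> Poly_Mapping.keys x" "p \<notin> Poly_Mapping.keys y"
        using in_carrier unfolding matsuo_carrier_def by auto
      then show ?thesis by (simp add: not_in_keys_iff_lookup_eq_zero)
    qed
  qed
qed

lemma (in vector_space) linear_extension_in_subspace:
  assumes "subspace B" "\<And>p. p \<in> P \<Longrightarrow> \<phi> p \<in> B" "x \<in> matsuo_carrier P"
  shows "linear_extension scale \<phi> x \<in> B"
  unfolding linear_extension_def using assms
  by (intro subspace_sum subspace_scale) (auto simp: matsuo_carrier_def)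

lemma algebra_on_mult_zero:
  assumes "algebra_on sc A mul" "a \<in> A"
  shows "mul 0 a = 0" "mul a 0 = 0"
proof -
  interpret vector_space sc using assms(1) unfolding algebra_on_def by simp
  have "0 \<in> A" using assms(1) subspace_0 unfolding algebra_on_def by blast
  then have "mul (0 + 0) a = mul 0 a + mul 0 a" "mul a (0 + 0) = mul a 0 + mul a 0"
    using assms unfolding algebra_on_def by blast+
  then show "mul 0 a = 0" "mul a 0 = 0" by simp_all
qed

lemma (in triple_system) linear_extension_matsuo_mult:
  assumes algebra: "algebra_on sc B mul" and images: "\<And>p. p \<in> P \<Longrightarrow> \<phi> p \<in> B"
    and axes: "\<And>p q. p \<in> P \<Longrightarrow> q \<in> P \<Longrightarrow> linear_extension sc \<phi> (axis_mult L \<delta> p q) = mul (\<phi> p) (\<phi> q)"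
    and x_in_carrier: "x \<in> matsuo_carrier P" and y_in_carrier: "y \<in> matsuo_carrier P"
  shows "linear_extension sc \<phi> (matsuo_mult L \<delta> x y) =
    mul (linear_extension sc \<phi> x) (linear_extension sc \<phi> y)"
proof -
  let ?F = "linear_extension sc \<phi>"
  interpret V: vector_space sc using algebra unfolding algebra_on_def by simp
  interpret F: module_hom pm_scale sc ?F by (rule V.module_hom_linear_extension)
  have subspace: "V.subspace B"
    and mult_add: "\<And>a b c. a \<in> B \<Longrightarrow> b \<in> B \<Longrightarrow> c \<in> B \<Longrightarrow>
      mul (a + b) c = mul a c + mul b c \<and> mul a (b + c) = mul a b + mul a c"
    and mult_scale: "\<And>k a b. a \<in> B \<Longrightarrow> b \<in> B \<Longrightarrow>
      mul (sc k a) b = sc k (mul a b) \<and> mul a (sc k b) = sc k (mul a b)"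
    using algebra unfolding algebra_on_def by blast+
  have F_in_B: "?F x \<in> B" if "x \<in> matsuo_carrier P" for x
    using subspace images that by (rule V.linear_extension_in_subspace)
  note extension = matsuo_mult_bilinear F.add F.scale V.linear_extension_axis V.subspace_scale[OF subspace]
  have axis_right: "?F (matsuo_mult L \<delta> x (axis q)) = mul (?F x) (\<phi> q)"
    if "x \<in> matsuo_carrier P" "q \<in> P" for x q
    using that(1)
  proof (induction rule: matsuo_carrier_induct)
    case zero
    then show ?case using algebra_on_mult_zero[OF algebra] images that(2) by (simp add: matsuo_mult_bilinear)
  next
    case (add c p y)
    then show ?case using that(2) F_in_B images axes
      by (simp add: extension matsuo_mult_axis mult_add mult_scale)
  qed
  show ?thesis
    using y_in_carrier
  proof (induction rule: matsuo_carrier_induct)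
    case zero
    then show ?case using algebra_on_mult_zero[OF algebra] F_in_B[OF x_in_carrier] by (simp add: matsuo_mult_bilinear)
  next
    case (add c q y)
    then show ?case using x_in_carrier F_in_B images by (simp add: extension axis_right mult_add mult_scale)
  qed
qed

lemma (in triple_system) jordan_algebra_matsuo_embedding:
  assumes jordan: "jordan_algebra sc B mul" and images: "\<And>p. p \<in> P \<Longrightarrow> \<phi> p \<in> B"
    and axes: "\<And>p q. p \<in> P \<Longrightarrow> q \<in> P \<Longrightarrow> linear_extension sc \<phi> (axis_mult L \<delta> p q) = mul (\<phi> p) (\<phi> q)"
    and dual: "\<And>p. p \<in> P \<Longrightarrow> \<exists>c. module_hom sc (*) c \<and> (\<forall>q\<in>P. c (\<phi> q) = of_bool (q = p))"
  shows "jordan_algebra pm_scale (matsuo_carrier P) (matsuo_mult L \<delta>)"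
proof (rule jordan_algebra_embedding[OF algebra_on_matsuo jordan])
  have algebra: "algebra_on sc B mul" using jordan unfolding jordan_algebra_def by simp
  then interpret vector_space sc unfolding algebra_on_def by simp
  have subspace: "subspace B" using algebra unfolding algebra_on_def by blast
  show "inj_on (linear_extension sc \<phi>) (matsuo_carrier P)"
    using dual by (rule inj_on_linear_extension)
  show "linear_extension sc \<phi> x \<in> B" if "x \<in> matsuo_carrier P" for x
    using subspace images that by (rule linear_extension_in_subspace)
  show "linear_extension sc \<phi> (matsuo_mult L \<delta> x y) =
      mul (linear_extension sc \<phi> x) (linear_extension sc \<phi> y)"
    if "x \<in> matsuo_carrier P" "y \<in> matsuo_carrier P" for x y
    using algebra images axes that by (rule linear_extension_matsuo_mult)
qed

subsection \<open>Complete graphs\<close>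

lemma special_jordan_algebra:
  assumes algebra: "algebra_on sc A mul"
    and assoc: "\<And>x y z. x \<in> A \<Longrightarrow> y \<in> A \<Longrightarrow> z \<in> A \<Longrightarrow> mul (mul x y) z = mul x (mul y z)"
  shows "jordan_algebra sc A (\<lambda>x y. sc k (mul x y + mul y x))"
proof -
  interpret vector_space sc using algebra unfolding algebra_on_def by simp
  have closed: "x + y \<in> A" "sc c x \<in> A" "mul x y \<in> A" if "x \<in> A" "y \<in> A" for c x y
    using algebra that subspace_add subspace_scale unfolding algebra_on_def by blast+
  have mult_add: "mul (x + y) z = mul x z + mul y z" "mul x (y + z) = mul x y + mul x z"
    if "x \<in> A" "y \<in> A" "z \<in> A" for x y z
    using algebra that unfolding algebra_on_def by blast+
  have mult_scale: "mul (sc c x) y = sc c (mul x y)" "mul x (sc c y) = sc c (mul x y)"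
    if "x \<in> A" "y \<in> A" for c x y
    using algebra that unfolding algebra_on_def by blast+
  have "algebra_on sc A (\<lambda>x y. sc k (mul x y + mul y x))"
    using algebra unfolding algebra_on_def
    by (simp add: closed mult_add mult_scale scale_right_distrib mult.commute add_ac)
  moreover have "sc k (mul x y + mul y x) = sc k (mul y x + mul x y)" for x y
    by (simp add: add.commute)
  moreover have "sc k (mul (sc k (mul (sc k (mul x x + mul x x)) y + mul y (sc k (mul x x + mul x x)))) x +
      mul x (sc k (mul (sc k (mul x x + mul x x)) y + mul y (sc k (mul x x + mul x x))))) =
    sc k (mul (sc k (mul x x + mul x x)) (sc k (mul y x + mul x y)) +
      mul (sc k (mul y x + mul x y)) (sc k (mul x x + mul x x)))"
    if "x \<in> A" "y \<in> A" for x y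
    using that by (simp add: closed mult_add mult_scale assoc scale_right_distrib add_ac)
  ultimately show ?thesis unfolding jordan_algebra_def by blast
qed

lemma (in vector_space) vector_space_operators: "vector_space (\<lambda>c F v. scale c (F v))"
  by unfold_locales (simp_all add: fun_eq_iff scale_right_distrib scale_left_distrib)

lemma (in vector_space) algebra_on_endomorphisms:
  "algebra_on (\<lambda>c F v. scale c (F v)) {F. module_hom scale scale F} (\<circ>)"
proof -
  interpret pair: module_pair scale scale ..
  interpret operators: vector_space "\<lambda>c (F :: 'b \<Rightarrow> 'b) v. scale c (F v)"
    by (rule vector_space_operators)
  have "operators.subspace {F. module_hom scale scale F}"
    by (rule operators.subspaceI)
      (auto simp: plus_fun_def zero_fun_def
        intro: pair.module_hom_zero pair.module_hom_add pair.module_hom_scale)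
  then show ?thesis
    unfolding algebra_on_def
    using vector_space_operators
    by (auto intro: module_hom_compose simp: fun_eq_iff module_hom.add module_hom.scale)
qed

definition fun_scale :: "'f::field \<Rightarrow> ('v \<Rightarrow> 'f) \<Rightarrow> 'v \<Rightarrow> 'f" where
  "fun_scale c v = (\<lambda>x. c * v x)"

interpretation fun_scale: vector_space "fun_scale :: 'f::field \<Rightarrow> ('v \<Rightarrow> 'f) \<Rightarrow> 'v \<Rightarrow> 'f"
  by unfold_locales (simp_all add: fun_scale_def fun_eq_iff algebra_simps)

text \<open>The projection onto the line spanned by the difference of the unit vectors at \<open>i\<close> and \<open>j\<close>.\<close>

definition edge_projection :: "'v \<Rightarrow> 'v \<Rightarrow> ('v \<Rightarrow> 'f::field) \<Rightarrow> 'v \<Rightarrow> 'f" where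
  "edge_projection i j v = (\<lambda>x. 1 / 2 * (v x - v (transpose i j x)))"

lemma edge_projection_commute: "edge_projection i j = edge_projection j i"
  by (simp add: edge_projection_def transpose_commute fun_eq_iff)

lemma module_hom_edge_projection: "module_hom fun_scale fun_scale (edge_projection i j)"
  by unfold_locales (simp_all add: edge_projection_def fun_scale_def fun_eq_iff algebra_simps)

definition operator_product ::
    "(('v \<Rightarrow> 'f::field) \<Rightarrow> 'v \<Rightarrow> 'f) \<Rightarrow> (('v \<Rightarrow> 'f) \<Rightarrow> 'v \<Rightarrow> 'f) \<Rightarrow> ('v \<Rightarrow> 'f) \<Rightarrow> 'v \<Rightarrow> 'f" where
  "operator_product F G = (\<lambda>v. fun_scale (1 / 2) (((F \<circ> G) + (G \<circ> F)) v))"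

abbreviation operator_scale ::
    "'f::field \<Rightarrow> (('v \<Rightarrow> 'f) \<Rightarrow> 'v \<Rightarrow> 'f) \<Rightarrow> ('v \<Rightarrow> 'f) \<Rightarrow> 'v \<Rightarrow> 'f" where
  "operator_scale c F \<equiv> \<lambda>v. fun_scale c (F v)"

interpretation operators: vector_space
    "operator_scale :: 'f::field \<Rightarrow> (('v \<Rightarrow> 'f) \<Rightarrow> 'v \<Rightarrow> 'f) \<Rightarrow> ('v \<Rightarrow> 'f) \<Rightarrow> 'v \<Rightarrow> 'f"
  by (rule fun_scale.vector_space_operators)

lemma jordan_algebra_operator_product:
  "jordan_algebra operator_scale {F. module_hom fun_scale fun_scale F} operator_product"
  unfolding operator_product_def
  by (rule special_jordan_algebra[OF fun_scale.algebra_on_endomorphisms]) (simp add: comp_assoc)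

lemma operator_product_edge_projection_self:
  assumes "(2::'f::field) \<noteq> 0"
  shows "operator_product (edge_projection i j) (edge_projection i j) =
    (edge_projection i j :: ('v \<Rightarrow> 'f) \<Rightarrow> _)"
proof (intro ext)
  fix v :: "'v \<Rightarrow> 'f" and x
  have halves: "1 / 2 * (y + y) = y" for y :: 'f
    using assms by (simp flip: mult_2)
  let ?e = "edge_projection i j :: ('v \<Rightarrow> 'f) \<Rightarrow> _"
  have "?e v (transpose i j x) = - ?e v x"
    by (simp add: edge_projection_def algebra_simps)
  then have "?e (?e v) x = ?e v x"
    unfolding edge_projection_def[of i j "?e v"] by (simp only: diff_minus_eq_add halves)
  then show "operator_product ?e ?e v x = ?e v x"
    by (simp only: operator_product_def fun_scale_def plus_fun_apply comp_apply halves)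
qed

lemma operator_product_edge_projection_disjoint:
  assumes "distinct [i, j, k, l]"
  shows "operator_product (edge_projection i j) (edge_projection k l) = 0"
  using assms
  by (intro ext) (auto simp: operator_product_def fun_scale_def edge_projection_def transpose_def)

lemma operator_product_edge_projection_adjacent:
  assumes "distinct [i, j, k]"
  shows "operator_product (edge_projection i j) (edge_projection j k) =
    (\<lambda>v. fun_scale (1 / 4) ((edge_projection i j + edge_projection j k - edge_projection i k) v))"
proof (intro ext)
  fix v :: "'a \<Rightarrow> 'b" and x
  define h :: 'b where "h = 1 / 2"
  have quarter: "1 / 4 = h * h" unfolding h_def by simp
  consider "x = i" | "x = j" | "x = k" | "x \<notin> {i, j, k}" by blast
  then show "operator_product (edge_projection i j) (edge_projection j k) v x =
    fun_scale (1 / 4) ((edge_projection i j + edge_projection j k - edge_projection i k) v) x"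
    unfolding operator_product_def fun_scale_def edge_projection_def quarter h_def[symmetric]
    by cases (use assms in \<open>auto simp: transpose_def algebra_simps\<close>)
qed

lemma edge_projection_dual:
  assumes "(2::'f::field) \<noteq> 0" "i \<noteq> j" "k \<noteq> l"
  shows "- 2 * edge_projection k l (\<lambda>x. of_bool (x = j)) i = (of_bool ({k, l} = {i, j}) :: 'f)"
  using assms by (auto simp: edge_projection_def transpose_def doubleton_eq_iff)

context edge_labelling
begin

context
  fixes \<phi> :: "'a \<Rightarrow> ('v \<Rightarrow> 'f::field) \<Rightarrow> 'v \<Rightarrow> 'f"
  assumes two: "(2::'f) \<noteq> 0"
    and \<phi>: "\<And>i j. i \<in> V \<Longrightarrow> j \<in> V \<Longrightarrow> i \<noteq> j \<Longrightarrow> \<phi> (g i j) = edge_projection i j"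
begin

lemma linear_extension_edge_projection:
  assumes "p \<in> edge_points V g" "q \<in> edge_points V g"
  shows "linear_extension operator_scale \<phi> (axis_mult L (1 / 4) p q) = operator_product (\<phi> p) (\<phi> q)"
proof -
  interpret \<phi>: module_hom pm_scale operator_scale "linear_extension operator_scale \<phi>"
    by (rule operators.module_hom_linear_extension)
  show ?thesis
    using assms
  proof (cases rule: edge_pair_cases)
    case equal
    obtain i j where "i \<in> V" "j \<in> V" "i \<noteq> j" "p = g i j" using assms(1) by (rule edge_pointsE)
    then show ?thesis
      using equal
      by (simp add: axis_mult_def operators.linear_extension_axis \<phi> operator_product_edge_projection_self[OF two])
  next
    case (disjoint i j k l)
    then show ?thesis
      using disjoint_edges[of i j k l]
      by (simp add: axis_mult_def \<phi> operator_product_edge_projection_disjoint)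
  next
    case (adjacent i j k)
    then show ?thesis
      using axis_mult_line[OF triangle_line[of i j k], of "1 / 4 :: 'f"]
      by (simp add: \<phi> \<phi>.scale \<phi>.add \<phi>.diff operators.linear_extension_axis
          operator_product_edge_projection_adjacent)
  qed
qed

lemma edge_projection_dual_functional:
  assumes "p \<in> edge_points V g"
  shows "\<exists>c. module_hom operator_scale (*) c \<and> (\<forall>q\<in>edge_points V g. c (\<phi> q) = of_bool (q = p))"
proof -
  obtain i j where p_edge: "i \<in> V" "j \<in> V" "i \<noteq> j" "p = g i j" using assms by (rule edge_pointsE)
  let ?c = "\<lambda>F. - 2 * F (\<lambda>x. of_bool (x = j)) i :: 'f"
  have "module_hom operator_scale (*) ?c"
    by unfold_locales (simp_all add: fun_scale_def algebra_simps)
  moreover have "?c (\<phi> q) = of_bool (q = p)" if "q \<in> edge_points V g" for q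
  proof -
    obtain k l where q_edge: "k \<in> V" "l \<in> V" "k \<noteq> l" "q = g k l"
      using \<open>q \<in> edge_points V g\<close> by (rule edge_pointsE)
    then show ?thesis
      using p_edge edge_projection_dual[OF two p_edge(3) q_edge(3)] edge_eq_iff[of k l i j]
      by (simp add: \<phi>)
  qed
  ultimately show ?thesis by blast
qed

end

theorem jordan_algebra_complete_graph:
  assumes "edge_points V g = P" and "(2::'f::field) \<noteq> 0"
  shows "jordan_algebra pm_scale (matsuo_carrier P) (matsuo_mult L (1 / 4 :: 'f))"
proof -
  obtain \<phi> where \<phi>_edge: "\<And>i j. i \<in> V \<Longrightarrow> j \<in> V \<Longrightarrow> i \<noteq> j \<Longrightarrow>
      \<phi> (g i j) = (edge_projection i j :: ('v \<Rightarrow> 'f) \<Rightarrow> _)"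
    using edge_projection_commute by (rule symmetric_function_on_edges) (rule that)
  show ?thesis
  proof (rule jordan_algebra_matsuo_embedding[OF jordan_algebra_operator_product])
    fix p assume p_in_P: "p \<in> P"
    then show "\<phi> p \<in> {F. module_hom fun_scale fun_scale F}"
      unfolding assms(1)[symmetric] by (auto elim!: edge_pointsE simp: \<phi>_edge module_hom_edge_projection)
    show "\<exists>c. module_hom operator_scale (*) c \<and> (\<forall>q\<in>P. c (\<phi> q) = of_bool (q = p))"
      using edge_projection_dual_functional[OF assms(2) \<phi>_edge] p_in_P by (simp add: assms(1))
    show "linear_extension operator_scale \<phi> (axis_mult L (1 / 4) p q) = operator_product (\<phi> p) (\<phi> q)"
      if "q \<in> P" for q
      using linear_extension_edge_projection[OF assms(2) \<phi>_edge] p_in_P that by (simp add: assms(1))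
  qed
qed

end

subsection \<open>Affine spaces\<close>

text \<open>Modelled on the group algebra of an abelian group of exponent 3, with \<open>E\<close> the augmentation and
  \<open>S\<close> the inversion of group elements.\<close>

lemma augmented_ring_jordan:
  fixes E S :: "'r::comm_ring_1 \<Rightarrow> 'r"
  assumes augmentation: "\<And>x y. E (x + y) = E x + E y" "\<And>x y. E (x * y) = E x * E y" "\<And>x. E (E x) = E x"
      "\<And>x. E (S x) = E x"
    and involution: "\<And>x y. S (x + y) = S x + S y" "\<And>x y. S (x * y) = S x * S y" "\<And>x. S (S x) = x"
      "\<And>x. S (E x) = E x"
    and cube: "\<And>x. x * x * x = E x * E x * E x"
  defines "mul \<equiv> \<lambda>x y. E y * x + E x * y - S (x * y)"
  shows "mul (mul (mul x x) y) x = mul (mul x x) (mul y x)"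
proof -
  have diff: "E (x - y) = E x - E y" "S (x - y) = S x - S y" for x y
    using augmentation(1)[of "x - y" y] involution(1)[of "x - y" y] by (simp_all add: algebra_simps)
  have "mul (mul (mul x x) y) x = mul (mul x x) (mul y x) + (x * x * x - S x * S x * S x) * y"
    unfolding mul_def augmentation involution diff by (simp add: algebra_simps)
  also have "S x * S x * S x = x * x * x" using cube[of "S x"] cube[of x] augmentation(4) by simp
  finally show ?thesis by simp
qed

lemma pm_scale_mult:
  fixes x y :: "'k::comm_monoid_add \<Rightarrow>\<^sub>0 'f::field"
  shows "pm_scale c x * y = pm_scale c (x * y)" "x * pm_scale c y = pm_scale c (x * y)"
  unfolding pm_scale_def mult_map_scale_conv_mult by (simp_all add: ac_simps)

lemma axis_mult_axis: "axis u * axis v = (axis (u + v) :: 'k::comm_monoid_add \<Rightarrow>\<^sub>0 'f::field)"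
  unfolding axis_def by (simp add: mult_single)

lemma poly_mapping_axis_induct [case_names zero add]:
  fixes x :: "'a \<Rightarrow>\<^sub>0 'f::field"
  assumes "R 0" "\<And>c p y. R y \<Longrightarrow> R (pm_scale c (axis p) + y)"
  shows "R x"
  using matsuo_carrier_induct[of x UNIV R] assms by (simp add: matsuo_carrier_def)

definition group_algebra_map :: "('k \<Rightarrow> 'm) \<Rightarrow> ('k \<Rightarrow>\<^sub>0 'f::field) \<Rightarrow> 'm \<Rightarrow>\<^sub>0 'f" where
  "group_algebra_map h = linear_extension pm_scale (\<lambda>v. axis (h v))"

lemma group_algebra_map_simps [simp]:
  "group_algebra_map h (x + y) = group_algebra_map h x + group_algebra_map h y"
  "group_algebra_map h (x - y) = group_algebra_map h x - group_algebra_map h y"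
  "group_algebra_map h (pm_scale c x) = pm_scale c (group_algebra_map h x)"
  "group_algebra_map h 0 = 0"
  "group_algebra_map h (axis v) = axis (h v)"
proof -
  interpret module_hom pm_scale pm_scale "group_algebra_map h"
    unfolding group_algebra_map_def by (rule pm.module_hom_linear_extension)
  show "group_algebra_map h (x + y) = group_algebra_map h x + group_algebra_map h y"
    "group_algebra_map h (x - y) = group_algebra_map h x - group_algebra_map h y"
    "group_algebra_map h (pm_scale c x) = pm_scale c (group_algebra_map h x)"
    "group_algebra_map h 0 = 0"
    by (rule add diff scale zero)+
  show "group_algebra_map h (axis v) = axis (h v)"
    by (simp add: group_algebra_map_def pm.linear_extension_axis)
qed

lemma group_algebra_map_mult:
  fixes h :: "'k::comm_monoid_add \<Rightarrow> 'm::comm_monoid_add"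
  assumes "\<And>u v. h (u + v) = h u + h v"
  shows "group_algebra_map h (x * y) = group_algebra_map h x * group_algebra_map h y"
proof (induction x rule: poly_mapping_axis_induct)
  case (add c u x)
  have "group_algebra_map h (axis u * y) = axis (h u) * group_algebra_map h y"
    by (induction y rule: poly_mapping_axis_induct)
      (simp_all add: distrib_left pm_scale_mult axis_mult_axis assms)
  then show ?case by (simp add: distrib_right pm_scale_mult add)
qed simp

lemma group_algebra_map_compose:
  "group_algebra_map h (group_algebra_map h' x) = group_algebra_map (h \<circ> h') x"
  by (induction x rule: poly_mapping_axis_induct) simp_all

lemma group_algebra_map_ident: "group_algebra_map (\<lambda>v. v) x = x"
  by (simp add: group_algebra_map_def axis_expansion)

lemma group_algebra_cube:
  fixes x :: "'k::comm_monoid_add \<Rightarrow>\<^sub>0 'f::field"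
  assumes "CHAR('f) = 3" and "\<And>v :: 'k. v + v + v = 0"
  shows "x * x * x =
      group_algebra_map (\<lambda>_. 0) x * group_algebra_map (\<lambda>_. 0) x * group_algebra_map (\<lambda>_. 0) x"
    (is "_ = ?E x * ?E x * ?E x")
proof (induction x rule: poly_mapping_axis_induct)
  case (add c v x)
  have "(3::'f) = 0" using assms(1) by (metis of_nat_CHAR of_nat_numeral)
  then have three: "(3 :: 'k \<Rightarrow>\<^sub>0 'f) = 0" by (metis single_numeral single_zero)
  have frobenius: "(y + z) * (y + z) * (y + z) = y * y * y + z * z * z" for y z :: "'k \<Rightarrow>\<^sub>0 'f"
  proof -
    have "(y + z) * (y + z) * (y + z) = y * y * y + z * z * z + 3 * (y * y * z + y * z * z)"
      by (simp add: algebra_simps)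
    then show ?thesis unfolding three by simp
  qed
  have "axis v * axis v * axis v = (axis 0 * axis 0 * axis 0 :: 'k \<Rightarrow>\<^sub>0 'f)"
    by (simp add: axis_mult_axis assms(2))
  then show ?case by (simp add: frobenius pm_scale_mult add)
qed simp

definition affine_product ::
    "('k::ab_group_add \<Rightarrow>\<^sub>0 'f::field) \<Rightarrow> ('k \<Rightarrow>\<^sub>0 'f) \<Rightarrow> 'k \<Rightarrow>\<^sub>0 'f" where
  "affine_product x y = group_algebra_map (\<lambda>_. 0) y * x + group_algebra_map (\<lambda>_. 0) x * y
     - group_algebra_map uminus (x * y)"

lemma affine_product_axis: "affine_product (axis u) (axis v) = axis u + axis v - axis (- u - v)"
  by (simp add: affine_product_def axis_mult_axis)

lemma jordan_algebra_affine_product: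
  assumes "CHAR('f::field) = 3" and "\<And>v :: 'k::ab_group_add. v + v + v = 0"
  shows "jordan_algebra pm_scale UNIV (affine_product :: ('k \<Rightarrow>\<^sub>0 'f) \<Rightarrow> _)"
proof -
  have "algebra_on pm_scale UNIV (affine_product :: ('k \<Rightarrow>\<^sub>0 'f) \<Rightarrow> _)"
    unfolding algebra_on_def
    by (simp add: pm.vector_space_axioms affine_product_def pm_scale_mult algebra_simps)
  moreover have "affine_product x y = affine_product y x" for x y :: "'k \<Rightarrow>\<^sub>0 'f"
    by (simp add: affine_product_def mult.commute add.commute)
  moreover have "affine_product (affine_product (affine_product x x) y) x =
      affine_product (affine_product x x) (affine_product y x)" for x y :: "'k \<Rightarrow>\<^sub>0 'f"
    unfolding affine_product_def
    by (rule augmented_ring_jordan)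
      (simp_all add: group_algebra_map_mult group_algebra_map_compose comp_def group_algebra_map_ident
        group_algebra_cube[OF assms, symmetric])
  ultimately show ?thesis unfolding jordan_algebra_def by blast
qed

theorem (in affine_labelling) jordan_algebra_affine:
  assumes "f ` affine_points k = P" and char: "CHAR('f::field) = 3"
  shows "jordan_algebra pm_scale (matsuo_carrier P) (matsuo_mult L (1 :: 'f))"
proof -
  obtain h where inverse: "\<And>u. u \<in> affine_points k \<Longrightarrow> h (f u) = u"
    using inv_into_f_f[of f "affine_points k"] label_eq_iff by (metis inj_onI)
  have "v + v + v = 0" for v :: "nat \<Rightarrow> 3" by (simp add: two_eq_minus_one)
  note jordan = jordan_algebra_affine_product[OF char this]
  interpret F: module_hom pm_scale pm_scale "linear_extension pm_scale (\<lambda>p. axis (h p) :: _ \<Rightarrow>\<^sub>0 'f)"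
    by (rule pm.module_hom_linear_extension)
  show ?thesis
  proof (rule jordan_algebra_matsuo_embedding[OF jordan])
    fix p q assume "p \<in> P" "q \<in> P"
    then obtain u v where p_label: "u \<in> affine_points k" "p = f u"
      and q_label: "v \<in> affine_points k" "q = f v"
      using assms(1) by blast
    have "axis_mult L 1 p q = axis p + axis q - (axis (f (- u - v)) :: _ \<Rightarrow>\<^sub>0 'f)"
    proof (cases "u = v")
      case True
      then show ?thesis using p_label q_label by (simp add: axis_mult_def minus_minus_self)
    next
      case False
      show ?thesis
        using axis_mult_line[OF label_line[OF p_label(1) q_label(1) False], of "1 :: 'f"] p_label(2) q_label(2)
        by simp
    qed
    then show "linear_extension pm_scale (\<lambda>p. axis (h p)) (axis_mult L 1 p q) =
        (affine_product (axis (h p)) (axis (h q)) :: _ \<Rightarrow>\<^sub>0 'f)"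
      using p_label q_label
      by (simp add: F.add F.diff pm.linear_extension_axis affine_product_axis inverse affine_points_closed)
  next
    fix p assume "p \<in> P"
    have "module_hom pm_scale (*) (\<lambda>x. Poly_Mapping.lookup x (h p) :: 'f)"
      by unfold_locales (simp_all add: lookup_add algebra_simps)
    moreover have "h q = h p \<longleftrightarrow> q = p" if "q \<in> P" for q
      using that \<open>p \<in> P\<close> assms(1) inverse by (metis imageE)
    ultimately show "\<exists>c. module_hom pm_scale (*) c \<and> (\<forall>q\<in>P. c (axis (h q)) = (of_bool (q = p) :: 'f))"
      by (intro exI[of _ "\<lambda>x. Poly_Mapping.lookup x (h p)"]) (simp add: lookup_axis)
  qed simp
qed

section \<open>Consequences of the Jordan identity\<close>

lemma jordan_algebra_linearized:
  fixes sc :: "'f::field \<Rightarrow> 'v::ab_group_add \<Rightarrow> 'v"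
  assumes jordan: "jordan_algebra sc A mul" and two: "(2::'f) \<noteq> 0"
    and mem: "x \<in> A" "y \<in> A" "z \<in> A" "b \<in> A"
  shows "mul z (mul (mul x y) b) + mul x (mul (mul y z) b) + mul y (mul (mul z x) b) =
    mul (mul x y) (mul z b) + mul (mul y z) (mul x b) + mul (mul z x) (mul y b)" (is "?lhs = ?rhs")
proof -
  interpret vector_space sc using jordan unfolding jordan_algebra_def algebra_on_def by simp
  have closed: "x + y \<in> A" "mul x y \<in> A" if "x \<in> A" "y \<in> A" for x y
    using jordan that subspace_add unfolding jordan_algebra_def algebra_on_def by blast+
  have mult_add: "mul (x + y) z = mul x z + mul y z" "mul x (y + z) = mul x y + mul x z"
    if "x \<in> A" "y \<in> A" "z \<in> A" for x y z
    using jordan that unfolding jordan_algebra_def algebra_on_def by blast+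
  have commute: "mul x y = mul y x" if "x \<in> A" "y \<in> A" for x y
    using jordan that unfolding jordan_algebra_def by blast
  define J where "J a = mul a (mul (mul a a) b) - mul (mul a a) (mul a b)" for a
  have J_zero: "J a = 0" if "a \<in> A" for a
  proof -
    have "mul (mul (mul a a) b) a = mul (mul a a) (mul b a)"
      using jordan that mem(4) unfolding jordan_algebra_def by blast
    then show ?thesis
      using commute[OF that closed(2)[OF closed(2)[OF that that] mem(4)]] commute[OF that mem(4)]
      by (simp add: J_def)
  qed
  have "J (x + y + z) - J (x + y) - J (y + z) - J (x + z) + J x + J y + J z = (?lhs + ?lhs) - (?rhs + ?rhs)"
    unfolding J_def
    by (simp add: mem closed mult_add commute[OF mem(2,1)] commute[OF mem(3,1)] commute[OF mem(3,2)] algebra_simps)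
  then have "sc 2 (?lhs - ?rhs) = 0"
    using mem by (simp add: J_zero closed scale_left_distrib[of 1 1, simplified] algebra_simps)
  then show ?thesis using two by simp
qed

locale jordan_matsuo = triple_system P L for P :: "'a set" and L +
  fixes \<delta> :: "'f::field"
  assumes two_nonzero: "(2::'f) \<noteq> 0" and delta_nonzero: "\<delta> \<noteq> 0"
    and jordan: "jordan_algebra pm_scale (matsuo_carrier P) (matsuo_mult L \<delta>)"
begin

abbreviation prod (infixl "\<bullet>" 70) where "prod \<equiv> matsuo_mult L \<delta>"

abbreviation ax :: "'a \<Rightarrow> ('a \<Rightarrow>\<^sub>0 'f)" where "ax \<equiv> axis"

abbreviation cf :: "('a \<Rightarrow>\<^sub>0 'f) \<Rightarrow> 'a \<Rightarrow> 'f" where "cf \<equiv> Poly_Mapping.lookup"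

lemma ax_line: "{p, q, r} \<in> L \<Longrightarrow> ax p \<bullet> ax q = pm_scale \<delta> (ax p + ax q - ax r)"
  by (simp add: matsuo_mult_axis axis_mult_line)

lemma ax_noncollinear: "p \<noteq> q \<Longrightarrow> \<not> col p q \<Longrightarrow> ax p \<bullet> ax q = 0"
  by (simp add: matsuo_mult_axis axis_mult_def)

lemma linearized_jordan_axes:
  assumes "p \<in> P" "q \<in> P" "s \<in> P" "t \<in> P"
  shows "ax s \<bullet> (ax p \<bullet> ax q \<bullet> ax t) + ax p \<bullet> (ax q \<bullet> ax s \<bullet> ax t) + ax q \<bullet> (ax s \<bullet> ax p \<bullet> ax t) =
    ax p \<bullet> ax q \<bullet> (ax s \<bullet> ax t) + ax q \<bullet> ax s \<bullet> (ax p \<bullet> ax t) + ax s \<bullet> ax p \<bullet> (ax q \<bullet> ax t)"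
  by (rule jordan_algebra_linearized[OF jordan two_nonzero]) (use assms in \<open>simp_all add: axis_in_carrier\<close>)

lemma coeff_line: "{a, b, c} \<in> L \<Longrightarrow>
    cf (ax a \<bullet> ax b) y = \<delta> * (of_bool (a = y) + of_bool (b = y) - of_bool (c = y))"
  by (simp add: ax_line lookup_add lookup_minus lookup_axis)

lemma coeff_outside:
  assumes "line_closed L Q" "a \<in> Q" "w \<notin> Q" "y \<in> Q" "y \<noteq> a"
  shows "cf (ax a \<bullet> ax w) y = 0"
proof (cases "col a w")
  case True
  then have line: "{a, w, third a w} \<in> L" by (rule third_line)
  then have "third a w \<notin> Q"
    using line_closedD[OF assms(1), of a "third a w" w] assms by (auto simp: insert_commute)
  then show ?thesis using coeff_line[OF line] assms by auto
next
  case False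
  moreover have "a \<noteq> w" using assms by blast
  ultimately show ?thesis by (simp add: ax_noncollinear)
qed

lemma coeff_two_step:
  assumes "line_closed L Q" "t \<notin> Q" "a \<in> Q" "b \<in> Q" "y \<in> Q" "y \<noteq> a"
  shows "cf (ax a \<bullet> (ax b \<bullet> ax t)) y = \<delta> * of_bool (col b t) * cf (ax a \<bullet> ax b) y"
proof (cases "col b t")
  case True
  then have line: "{b, t, third b t} \<in> L" by (rule third_line)
  then have "third b t \<notin> Q"
    using line_closedD[OF assms(1), of b "third b t" t] assms by (auto simp: insert_commute)
  then show ?thesis using True ax_line[OF line] assms
    by (simp add: matsuo_mult_bilinear lookup_add lookup_minus coeff_outside[OF assms(1)])
next
  case False
  moreover have "b \<noteq> t" using assms by blast
  ultimately show ?thesis by (simp add: ax_noncollinear matsuo_mult_bilinear)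
qed

text \<open>The coefficient of \<open>z\<close> in the linearized identity for \<open>p\<close>, \<open>q\<close>, \<open>x\<close> acting on \<open>t\<close>.\<close>

lemma affine_configuration:
  assumes closed: "line_closed L Q" and outside: "t \<notin> Q" "t \<in> P"
    and mem: "{x, y, z, p, q, w, v} \<subseteq> Q"
    and lines: "{x, y, z} \<in> L" "{p, q, y} \<in> L" "{q, x, w} \<in> L" "{x, p, v} \<in> L"
      "{w, p, w'} \<in> L" "{v, q, v'} \<in> L"
    and different: "z \<notin> {p, q, w, v, w', v'}"
  shows "col x t \<longleftrightarrow> col y t"
proof -
  let ?\<chi> = "\<lambda>a. of_bool (col a t) :: 'f"
  have different_from_z: "x \<noteq> z" "y \<noteq> z" "p \<noteq> z" "q \<noteq> z" "w \<noteq> z" "v \<noteq> z" "w' \<noteq> z" "v' \<noteq> z"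
    using line_distinct[OF lines(1)] different by auto
  have swapped: "{y, x, z} \<in> L" "{p, x, v} \<in> L" "{x, q, w} \<in> L" "{q, p, y} \<in> L"
     "{p, w, w'} \<in> L" "{q, v, v'} \<in> L"
    using lines by (auto simp: insert_commute)
  note products = lines(2-4)[THEN ax_line]
  note coeffs = lines[THEN coeff_line, of z] swapped[THEN coeff_line, of z]
  have "p \<in> P" "q \<in> P" "x \<in> P" using lines(1,2) line_points by blast+
  then have "cf (ax x \<bullet> (ax p \<bullet> ax q \<bullet> ax t) + ax p \<bullet> (ax q \<bullet> ax x \<bullet> ax t) + ax q \<bullet> (ax x \<bullet> ax p \<bullet> ax t)) z =
    cf (ax p \<bullet> ax q \<bullet> (ax x \<bullet> ax t) + ax q \<bullet> ax x \<bullet> (ax p \<bullet> ax t) + ax x \<bullet> ax p \<bullet> (ax q \<bullet> ax t)) z"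
    using linearized_jordan_axes outside(2) by simp
  then have "\<delta> * (\<delta> * (\<delta> * ?\<chi> y)) = \<delta> * (\<delta> * (\<delta> * ?\<chi> x))"
    using different_from_z different_from_z[symmetric] mem
    by (simp add: products matsuo_mult_bilinear lookup_add lookup_minus lookup_axis
        coeff_two_step[OF closed outside(1)] coeffs)
  then show ?thesis using delta_nonzero by (auto simp: of_bool_def split: if_splits)
qed

lemma collinear_affine_labels:
  assumes "affine_labelling P L k f" and outside: "t \<in> P" "t \<notin> f ` affine_points k"
    and mem: "u \<in> affine_points k" "v \<in> affine_points k" "w \<in> affine_points k"
    and different: "u \<noteq> v" "w \<notin> {u, v, - u - v}"
  shows "col (f u) t \<longleftrightarrow> col (f v) t"
proof -
  interpret affine_labelling P L k f by fact
  define q m n where "q = - w - v" and "m = - q - u" and "n = - u - w"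
  note q_m_n = q_def m_def n_def
  have new_mem: "- u - v \<in> affine_points k" "q \<in> affine_points k" "m \<in> affine_points k"
      "n \<in> affine_points k" "- m - w \<in> affine_points k" "- n - q \<in> affine_points k"
    using mem by (simp_all add: q_m_n affine_points_def)
  have "q \<noteq> w" "q \<noteq> u" "m \<noteq> w" "n \<noteq> q" "u \<noteq> w"
    using different unfolding q_m_n
    by (auto simp: algebra_simps two_eq_minus_one eq_neg_iff_add_eq_0 neg_eq_iff_add_eq_0)
  then have lines: "{f u, f v, f (- u - v)} \<in> L" "{f w, f q, f v} \<in> L" "{f q, f u, f m} \<in> L"
      "{f u, f w, f n} \<in> L" "{f m, f w, f (- m - w)} \<in> L" "{f n, f q, f (- n - q)} \<in> L"
    using label_line[of u v] label_line[of w q] label_line[of q u] label_line[of u w] label_line[of m w]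
      label_line[of n q] mem new_mem different(1) by (auto simp: q_m_n)
  have "- u - v \<notin> {w, q, m, n, - m - w, - n - q}"
    using different unfolding q_m_n by (auto simp: algebra_simps two_eq_minus_one)
  then have "f (- u - v) \<notin> {f w, f q, f m, f n, f (- m - w), f (- n - q)}"
    using label_eq_iff[OF new_mem(1)] mem new_mem by simp
  then show ?thesis
    using mem new_mem by (intro affine_configuration[OF line_closed_labels outside(2,1) _ lines]) auto
qed

text \<open>The coefficient of \<open>g i l\<close> in the linearized identity for \<open>g i j\<close>, \<open>g j k\<close>, \<open>g k l\<close> acting
  on \<open>t\<close>.\<close>

lemma opposite_edges_balanced:
  assumes "edge_labelling P L V g" and outside: "t \<in> P" "t \<notin> edge_points V g"
    and vertices: "{i, j, k, l} \<subseteq> V" and distinct: "distinct [i, j, k, l]"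
  shows "(of_bool (col (g i j) t) + of_bool (col (g k l) t) :: nat) =
    of_bool (col (g i k) t) + of_bool (col (g j l) t)"
proof -
  interpret edge_labelling P L V g by fact
  let ?\<chi> = "\<lambda>a. of_bool (col a t) :: 'f"
  have mem: "{g i j, g i k, g i l, g j k, g j l, g k l} \<subseteq> edge_points V g"
    using vertices distinct by (simp add: edge_pointsI)
  have lines: "{g i j, g j k, g i k} \<in> L" "{g j k, g k l, g j l} \<in> L" "{g k l, g i k, g i l} \<in> L"
      "{g i j, g j l, g i l} \<in> L"
    using triangle_line[of i j k] triangle_line[of j k l] triangle_line[of i k l] triangle_line[of i j l]
      vertices distinct
    by (auto simp: insert_commute)
  then have swapped: "{g j k, g i j, g i k} \<in> L" "{g k l, g j k, g j l} \<in> L" "{g i k, g k l, g i l} \<in> L"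
      "{g j l, g i j, g i l} \<in> L"
    by (auto simp: insert_commute)
  have different: "g i j \<noteq> g i l" "g i k \<noteq> g i l" "g j k \<noteq> g i l" "g j l \<noteq> g i l" "g k l \<noteq> g i l"
    using vertices distinct by (auto simp: edge_eq_iff doubleton_eq_iff)
  have zero: "ax (g k l) \<bullet> ax (g i j) = 0" "ax (g i j) \<bullet> ax (g k l) = 0"
    using disjoint_edges[of i j k l] disjoint_edges[of k l i j] vertices distinct by (auto intro!: ax_noncollinear)
  note coeffs = lines[THEN coeff_line, of "g i l"] swapped[THEN coeff_line, of "g i l"]
  have "cf (ax (g k l) \<bullet> (ax (g i j) \<bullet> ax (g j k) \<bullet> ax t) + ax (g i j) \<bullet> (ax (g j k) \<bullet> ax (g k l) \<bullet> ax t)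
        + ax (g j k) \<bullet> (ax (g k l) \<bullet> ax (g i j) \<bullet> ax t)) (g i l) =
    cf (ax (g i j) \<bullet> ax (g j k) \<bullet> (ax (g k l) \<bullet> ax t) + ax (g j k) \<bullet> ax (g k l) \<bullet> (ax (g i j) \<bullet> ax t)
        + ax (g k l) \<bullet> ax (g i j) \<bullet> (ax (g j k) \<bullet> ax t)) (g i l)"
    using linearized_jordan_axes[of "g i j" "g j k" "g k l" t] lines(1,2) line_points outside(1) by metis
  then have "\<delta> * (\<delta> * (\<delta> * (?\<chi> (g i k) + ?\<chi> (g j l)))) = \<delta> * (\<delta> * (\<delta> * (?\<chi> (g i j) + ?\<chi> (g k l))))"
    using mem different different[symmetric]
    by (simp add: zero lines(1,2)[THEN ax_line] matsuo_mult_bilinear lookup_add lookup_minus lookup_axis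
        coeff_two_step[OF line_closed_edge_points outside(2)] coeffs algebra_simps)
  then have "?\<chi> (g i k) + ?\<chi> (g j l) = ?\<chi> (g i j) + ?\<chi> (g k l)"
    using delta_nonzero by simp
  moreover have "(1::'f) \<noteq> 2" by (metis add_cancel_right_right one_add_one one_neq_zero)
  ultimately show ?thesis
    using two_nonzero by (auto simp: of_bool_def split: if_splits)
qed

end

section \<open>Planes of Fischer spaces\<close>

lemma affine_plane_point_outside:
  fixes u v w :: "nat \<Rightarrow> 3"
  shows "\<exists>x\<in>affine_points 2. x \<notin> {u, v, w}"
proof -
  define F where "F = (\<lambda>(a, b). (0 :: nat \<Rightarrow> 3)(0 := a, 1 := b))"
  have "inj F"
    by (rule injI) (auto simp: F_def fun_upd_def fun_eq_iff split: if_splits)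
  then have "card (range F) = CARD(3 \<times> 3)" by (simp add: card_image)
  then have "card {u, v, w} < card (range F)"
    using card_insert_le_m1 by (simp add: card_insert_if)
  then have "\<not> range F \<subseteq> {u, v, w}" by (meson card_mono finite.emptyI finite.insertI leD)
  moreover have "range F \<subseteq> affine_points 2" by (auto simp: F_def affine_points_def)
  ultimately show ?thesis by blast
qed

text \<open>The points of the dual affine plane as the edges of the complete graph on \<open>{0, 1, 2, 3}\<close>; the
  pairs \<open>01\<close>, \<open>25\<close>, \<open>34\<close> of noncollinear points are the pairs of opposite edges.\<close>

definition dual_affine_edge :: "nat \<Rightarrow> nat \<Rightarrow> nat" where
  "dual_affine_edge i j =
    (if {i, j} = {0, 1} then 0 else if {i, j} = {2, 3} then 1
     else if {i, j} = {0, 2} then 2 else if {i, j} = {1, 3} then 5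
     else if {i, j} = {1, 2} then 3 else 4)"

lemma edge_points_dual_affine_edge: "edge_points {0, 1, 2, 3} dual_affine_edge = dual_affine_points"
proof -
  have "edge_points V e = (\<Union>i\<in>V. \<Union>j\<in>V - {i}. {e i j})" for V and e :: "nat \<Rightarrow> nat \<Rightarrow> nat"
    unfolding edge_points_def by blast
  moreover have "(\<Union>i\<in>{0, 1, 2, 3}. \<Union>j\<in>{0, 1, 2, 3} - {i}. {dual_affine_edge i j}) = dual_affine_points"
    by code_simp
  ultimately show ?thesis by simp
qed

lemma dual_affine_edge_triangle:
  assumes "{i, j, k} \<subseteq> {0, 1, 2, 3}" "distinct [i, j, k]"
  shows "{dual_affine_edge i j, dual_affine_edge j k, dual_affine_edge i k} \<in> dual_affine_lines"
proof -
  have "\<forall>i\<in>{0, 1, 2, 3}. \<forall>j\<in>{0, 1, 2, 3}. \<forall>k\<in>{0, 1, 2, 3}. distinct [i, j, k] \<longrightarrow>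
      {dual_affine_edge i j, dual_affine_edge j k, dual_affine_edge i k} \<in> dual_affine_lines"
    by code_simp
  then show ?thesis using assms by blast
qed

lemma dual_affine_edge_disjoint:
  assumes "{i, j, k, l} \<subseteq> {0, 1, 2, 3}" "distinct [i, j, k, l]"
  shows "dual_affine_edge i j \<noteq> dual_affine_edge k l"
    and "{dual_affine_edge i j, dual_affine_edge k l, r} \<notin> dual_affine_lines"
proof -
  have "\<forall>i\<in>{0, 1, 2, 3}. \<forall>j\<in>{0, 1, 2, 3}. \<forall>k\<in>{0, 1, 2, 3}. \<forall>l\<in>{0, 1, 2, 3}. distinct [i, j, k, l] \<longrightarrow>
      dual_affine_edge i j \<noteq> dual_affine_edge k l \<and>
      (\<forall>m\<in>dual_affine_lines. \<not> {dual_affine_edge i j, dual_affine_edge k l} \<subseteq> m)"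
    by code_simp
  then have "dual_affine_edge i j \<noteq> dual_affine_edge k l \<and>
      (\<forall>m\<in>dual_affine_lines. \<not> {dual_affine_edge i j, dual_affine_edge k l} \<subseteq> m)"
    using assms by blast
  then show "dual_affine_edge i j \<noteq> dual_affine_edge k l"
    "{dual_affine_edge i j, dual_affine_edge k l, r} \<notin> dual_affine_lines"
    by auto
qed

lemma dual_affine_edge_commute: "dual_affine_edge i j = dual_affine_edge j i"
  unfolding dual_affine_edge_def by (simp add: insert_commute)

lemma (in triple_system) isomorphic_dual_affineE:
  assumes "isomorphic_systems Q {l \<in> L. l \<subseteq> Q} dual_affine_points dual_affine_lines"
    and "line_closed L Q" "Q \<subseteq> P"
  obtains g where "edge_labelling P L {0::nat, 1, 2, 3} g" "edge_points {0, 1, 2, 3} g = Q"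
proof (rule edge_labelling_of_isomorphism[OF assms(1) _ assms(2,3) dual_affine_edge_commute
      edge_points_dual_affine_edge])
  show "dual_affine_lines \<subseteq> Pow dual_affine_points"
    unfolding dual_affine_lines_def dual_affine_points_def by auto
  show "dual_affine_edge i j \<noteq> dual_affine_edge k l \<and>
      {dual_affine_edge i j, dual_affine_edge k l, x} \<notin> dual_affine_lines"
    if "{i, j, k, l} \<subseteq> {0, 1, 2, 3}" "distinct [i, j, k, l]" for i j k l x
    using dual_affine_edge_disjoint[OF that] by simp
qed (rule dual_affine_edge_triangle that, assumption+)+

lemma (in edge_labelling) triangle_and_edgeE:
  assumes "card V = 4" and line: "l \<in> L" "l \<subseteq> edge_points V g" and edge: "t \<in> edge_points V g" "t \<notin> l"
  obtains a b c d where "V = {a, b, c, d}" "distinct [a, b, c, d]" "l = {g a b, g b c, g a c}" "t = g a d"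
proof -
  obtain p q r where "l = {p, q, r}" using lineE[OF line(1)] .
  then obtain i j k where vertices: "{i, j, k} \<subseteq> V" "distinct [i, j, k]" and l_eq: "l = {g i j, g j k, g i k}"
    using line_through_edgesE[of p q r] line by (metis insert_subset)
  have "card (V - {i, j, k}) = 1" using assms(1) vertices by (simp add: card_Diff_subset)
  then obtain d where fourth: "V - {i, j, k} = {d}" by (rule card_1_singletonE)
  then have V_eq: "V = {i, j, k, d}" using vertices(1) by blast
  have d_new: "d \<notin> {i, j, k}" using fourth by blast
  obtain x y where t_eq: "x \<in> V" "y \<in> V" "x \<noteq> y" "t = g x y" using edge_pointsE[OF edge(1)] .
  have "\<not> {x, y} \<subseteq> {i, j, k}"
  proof
    assume "{x, y} \<subseteq> {i, j, k}"
    then have "{x, y} \<in> {{i, j}, {j, k}, {i, k}}" using t_eq(3) by auto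
    then have "g x y \<in> {g i j, g j k, g i k}" using edge_cong[of x y] by blast
    then show False using edge(2) t_eq(4) l_eq by simp
  qed
  then consider (i) "t = g i d" | (j) "t = g j d" | (k) "t = g k d"
    using t_eq edge_commute[of d] unfolding V_eq by auto
  then show thesis
  proof cases
    case i
    then show ?thesis using that[of i j k d] V_eq vertices(2) d_new l_eq by auto
  next
    case j
    then show ?thesis
      using that[of j k i d] V_eq vertices(2) d_new l_eq edge_commute[of j i] edge_commute[of k i] by auto
  next
    case k
    then show ?thesis
      using that[of k i j d] V_eq vertices(2) d_new l_eq edge_commute[of k i] edge_commute[of k j] by auto
  qed
qed

definition (in triple_system) affine_plane :: "'a set \<Rightarrow> bool" where
  "affine_plane Q \<longleftrightarrow> (\<exists>f. affine_labelling P L 2 f \<and> f ` affine_points 2 = Q)"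

lemma (in triple_system) affine_plane_collinear:
  assumes "affine_plane Q" "p \<in> Q" "q \<in> Q" "p \<noteq> q"
  shows "col p q"
  using assms affine_labelling.labels_collinear unfolding affine_plane_def by metis

lemma (in triple_system) affine_plane_closed:
  assumes "affine_plane Q"
  shows "line_closed L Q" "Q \<subseteq> P"
  using assms affine_labelling.line_closed_labels affine_labelling.labels_subset
  unfolding affine_plane_def by blast+

locale fischer_system = triple_system P L for P :: "'a set" and L +
  assumes fischer_space: "fischer_space P L"
begin

lemma line_point_planeE:
  assumes line: "l \<in> L" and off_line: "t \<notin> l" and collinear: "y \<in> l" "col t y"
  obtains (affine) Q where "affine_plane Q" "l \<subseteq> Q" "t \<in> Q"
    | (dual) g and a b c d :: nat where "edge_labelling P L {a, b, c, d} g" "distinct [a, b, c, d]"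
      "l = {g a b, g b c, g a c}" "t = g a d"
proof -
  obtain m where second_line: "m \<in> L" "t \<in> m" "y \<in> m" using collinear unfolding collinear_def by blast
  define Q where "Q = line_hull L (l \<union> m)"
  have lines_subset: "l \<union> m \<subseteq> P" using line second_line line_subset by blast
  have hull: "line_closed L Q" "Q \<subseteq> P" "l \<subseteq> Q" "t \<in> Q"
    using line_closed_hull[of L "l \<union> m"] line_hull_subset[OF lines_subset]
      hull_subset[of "l \<union> m" "line_closed L"] second_line(2)
    unfolding Q_def by auto
  have "generated_subsystem P L (l \<union> m) Q {l \<in> L. l \<subseteq> Q}"
    using lines_subset by (simp add: generated_subsystem_iff Q_def)
  then have "plane P L Q {l \<in> L. l \<subseteq> Q}"
    unfolding plane_def using line second_line off_line collinear by blast
  then consider (dual_affine) "isomorphic_systems Q {l \<in> L. l \<subseteq> Q} dual_affine_points dual_affine_lines"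
    | (affine_iso) "isomorphic_systems Q {l \<in> L. l \<subseteq> Q} (affine_points 2) (affine_lines 2)"
    using fischer_space unfolding fischer_space_def by blast
  then show thesis
  proof cases
    case dual_affine
    then obtain g where labelling: "edge_labelling P L {0::nat, 1, 2, 3} g" "edge_points {0, 1, 2, 3} g = Q"
      using hull(1,2) by (rule isomorphic_dual_affineE)
    interpret edge_labelling P L "{0::nat, 1, 2, 3}" g by (rule labelling(1))
    obtain a b c d where "{0::nat, 1, 2, 3} = {a, b, c, d}" "distinct [a, b, c, d]"
      "l = {g a b, g b c, g a c}" "t = g a d"
      by (rule triangle_and_edgeE[of l t]) (use line off_line hull(3,4) labelling(2) in auto)
    then show ?thesis using dual labelling(1) by metis
  next
    case affine_iso
    then have "affine_plane Q" using hull(2) isomorphic_affineE unfolding affine_plane_def by metis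
    then show ?thesis using affine hull(3,4) by blast
  qed
qed

lemma affine_plane_of_collinear_lineE:
  assumes "l \<in> L" "t \<notin> l" and collinear: "\<And>y. y \<in> l \<Longrightarrow> col t y"
  obtains Q where "affine_plane Q" "l \<subseteq> Q" "t \<in> Q"
proof -
  obtain y where "y \<in> l" using lineE[OF assms(1)] by blast
  from assms(1,2) this collinear[OF this] show thesis
  proof (cases rule: line_point_planeE)
    case (affine Q)
    then show ?thesis by (rule that)
  next
    case (dual g a b c d)
    then have "\<not> col t (g b c)" using edge_labelling.disjoint_edges[OF dual(1), of a d b c] by auto
    then show ?thesis using collinear[of "g b c"] dual(3) by simp
  qed
qed

end

section \<open>Fischer spaces without affine planes\<close>

locale dual_fischer_system = fischer_system P L for P :: "'a set" and L +
  assumes no_affine_plane: "\<not> affine_plane Q"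
begin

lemma line_point_edgesE:
  assumes "{x, y, z} \<in> L" "t \<notin> {x, y, z}" "col t y"
  obtains g and a b c d :: nat where "edge_labelling P L {a, b, c, d} g" "distinct [a, b, c, d]"
    "{x, y, z} = {g a b, g b c, g a c}" "t = g a d"
  using assms no_affine_plane by (elim line_point_planeE[of "{x, y, z}" t y]) auto

lemma collinear_two_points_of_line:
  assumes line: "{x, y, z} \<in> L" and off_line: "t \<notin> {x, y, z}" "\<not> col t x" "col t y"
  shows "col t z" "{third t y, third t z, x} \<in> L" "\<not> col (third t y) z"
proof -
  obtain g and a b c d :: nat where labelling: "edge_labelling P L {a, b, c, d} g"
    and distinct: "distinct [a, b, c, d]"
    and line_eq: "{x, y, z} = {g a b, g b c, g a c}" and t_eq: "t = g a d"
    using line off_line(1,3) by (rule line_point_edgesE)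
  interpret edge_labelling P L "{a, b, c, d}" g by (rule labelling)
  have triangles: "{t, g a b, g b d} \<in> L" "{t, g a c, g c d} \<in> L" "{g b d, g c d, g b c} \<in> L"
    using triangle_line[of b a d] triangle_line[of c a d] triangle_line[of b d c] distinct
    by (auto simp: t_eq insert_commute edge_commute)
  have mem: "x \<in> {g a b, g b c, g a c}" "y \<in> {g a b, g b c, g a c}" "z \<in> {g a b, g b c, g a c}"
    unfolding line_eq[symmetric] by simp_all
  have "col t (g a b)" "col t (g a c)" using triangles(1,2)[THEN line_col(1)] .
  then have x_eq: "x = g b c" using mem(1) off_line(2) by auto
  have y_z_cases: "y = g a b \<and> z = g a c \<or> y = g a c \<and> z = g a b"
    using x_eq mem(2,3) line_distinct[OF line] by auto
  have third: "third t (g a b) = g b d" "third t (g a c) = g c d"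
    using triangles(1,2)[THEN third_eq] .
  have disjoint: "\<not> col (g b d) (g a c)" "\<not> col (g c d) (g a b)"
    using disjoint_edges[of b d a c] disjoint_edges[of c d a b] distinct by auto
  show "col t z" using y_z_cases triangles(1,2) line_col(1) by blast
  show "{third t y, third t z, x} \<in> L"
    using y_z_cases third x_eq triangles(3) by (auto simp: insert_commute)
  show "\<not> col (third t y) z"
    using y_z_cases third disjoint by auto
qed

lemma line_parity:
  assumes line: "{x, y, z} \<in> L" and off_line: "t \<notin> {x, y, z}"
  shows "col t z \<longleftrightarrow> col t x \<noteq> col t y"
proof -
  have "\<not> (col t x \<and> col t y \<and> col t z)"
    using affine_plane_of_collinear_lineE[OF line off_line] no_affine_plane by auto
  moreover have "{y, x, z} \<in> L" "{x, z, y} \<in> L" "{z, x, y} \<in> L" "{z, y, x} \<in> L" "{y, z, x} \<in> L"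
    using line by (auto simp: insert_commute)
  ultimately show ?thesis using collinear_two_points_of_line(1) line off_line by blast
qed

lemma exists_collinear_generator:
  assumes connected: "connected_system P L" and generators: "S \<subseteq> P" "line_hull L S = P"
    and closed: "line_closed L Q" "Q \<noteq> {}" "Q \<subset> P"
  obtains s q where "s \<in> S" "s \<notin> Q" "q \<in> Q" "col s q"
proof (rule ccontr)
  assume "\<not> thesis"
  define N where "N = {t \<in> P. \<forall>q\<in>Q. \<not> col t q}"
  have not_col: "\<not> col q t" "\<not> col t q" if "q \<in> Q" "t \<in> N" for q t
    using that col_sym unfolding N_def by blast+
  have "line_closed L (Q \<union> N)"
    unfolding line_closed_def
  proof (intro allI impI)
    fix p q r assume line: "{p, q, r} \<in> L" and two_points: "p \<in> Q \<union> N" "q \<in> Q \<union> N"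
    show "r \<in> Q \<union> N"
    proof (rule ccontr)
      assume new_third: "r \<notin> Q \<union> N"
      then obtain x where neighbour: "x \<in> Q" "col r x" using line_points(3)[OF line] unfolding N_def by blast
      have "p \<notin> Q \<or> q \<notin> Q" using line_closedD[OF closed(1) line] new_third by blast
      then have p_q_in_N: "p \<in> N" "q \<in> N" using two_points not_col line_col[OF line] by blast+
      have "x \<notin> {p, q, r}" using not_col p_q_in_N neighbour new_third line_col[OF line] by blast
      then show False
        using line_parity[OF line, of x] not_col[OF neighbour(1)] p_q_in_N neighbour(2) col_sym by blast
    qed
  qed
  moreover have "S \<subseteq> Q \<union> N" using generators(1) \<open>\<not> thesis\<close> that unfolding N_def by blast
  ultimately have "P \<subseteq> Q \<union> N" using hull_minimal[of S "Q \<union> N" "line_closed L"] generators(2) by simp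
  obtain q where q_in_Q: "q \<in> Q" using closed(2) by blast
  have "p \<in> Q" if "p \<in> P" for p
    using connected _ that
  proof (rule connected_system_induct[where p = q])
    show "y \<in> Q" if "x \<in> Q" "col x y" for x y
      using that not_col col_points(2)[OF that(2)] \<open>P \<subseteq> Q \<union> N\<close> by blast
  qed (use q_in_Q closed(3) in auto)
  then show False using closed(3) by blast
qed

end

text \<open>A point \<open>t\<close> collinear with exactly the edges at the vertex \<open>a\<close> of a complete graph becomes the edge
  joining \<open>a\<close> to a new vertex \<open>v\<close>.\<close>

locale edge_star = dual_fischer_system P L + edge_labelling P L V g
  for P :: "'a set" and L and V :: "'v set" and g +
  fixes t :: 'a and a v :: 'v
  assumes t_in_P: "t \<in> P" and t_new: "t \<notin> edge_points V g" and a_in_V: "a \<in> V"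
    and star_iff: "i \<in> V \<Longrightarrow> j \<in> V \<Longrightarrow> i \<noteq> j \<Longrightarrow> col t (g i j) \<longleftrightarrow> i = a \<or> j = a"
    and v_new: "v \<notin> V"
begin

definition spoke :: "'v \<Rightarrow> 'a" where
  "spoke i = (if i = a then t else third t (g a i))"

definition cone :: "'v \<Rightarrow> 'v \<Rightarrow> 'a" where
  "cone i j = (if i = v then spoke j else if j = v then spoke i else g i j)"

lemma spoke_line: "i \<in> V \<Longrightarrow> i \<noteq> a \<Longrightarrow> {t, g a i, spoke i} \<in> L"
  using third_line[of t "g a i"] star_iff[of a i] a_in_V unfolding spoke_def by auto

lemma spoke_in_P: "i \<in> V \<Longrightarrow> spoke i \<in> P"
  using spoke_line[of i] t_in_P line_points(3) by (cases "i = a") (auto simp: spoke_def)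

lemma spoke_not_edge:
  assumes "i \<in> V"
  shows "spoke i \<notin> edge_points V g"
proof (cases "i = a")
  case True
  then show ?thesis using t_new by (simp add: spoke_def)
next
  case False
  then have "{spoke i, g a i, t} \<in> L" using spoke_line[OF assms] by (simp add: insert_commute)
  then show ?thesis
    using line_closedD[OF line_closed_edge_points] edge_pointsI[of a V i g] False assms a_in_V t_new by metis
qed

lemma spokes_line:
  assumes "i \<in> V" "j \<in> V" "i \<noteq> j"
  shows "{spoke i, spoke j, g i j} \<in> L"
proof -
  consider (i_centre) "i = a" | (j_centre) "j = a" | (no_centre) "i \<noteq> a" "j \<noteq> a" by blast
  then show ?thesis
  proof cases
    case i_centre
    then show ?thesis using spoke_line[of j] assms by (simp add: spoke_def insert_commute)
  next
    case j_centre
    then show ?thesis using spoke_line[of i] assms edge_commute[of i a] by (simp add: spoke_def insert_commute)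
  next
    case no_centre
    then have "{g i j, g a i, g a j} \<in> L"
      using triangle_line[of i a j] edge_commute[of i a] assms a_in_V by (simp add: insert_commute)
    moreover have "t \<notin> {g i j, g a i, g a j}" using t_new no_centre assms a_in_V by (auto simp: edge_pointsI)
    ultimately have "{third t (g a i), third t (g a j), g i j} \<in> L"
      using star_iff no_centre assms a_in_V by (intro collinear_two_points_of_line(2)) auto
    then show ?thesis using no_centre by (simp add: spoke_def)
  qed
qed

lemma spoke_not_collinear_at_centre:
  assumes "i \<in> V" "k \<in> V" "distinct [i, a, k]"
  shows "\<not> col (spoke i) (g a k)"
proof -
  have "{g i k, g a i, g a k} \<in> L"
    using triangle_line[of i a k] edge_commute[of i a] assms a_in_V by (auto simp: insert_commute)
  moreover have "t \<notin> {g i k, g a i, g a k}" using t_new assms a_in_V by (auto simp: edge_pointsI)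
  ultimately have "\<not> col (third t (g a i)) (g a k)"
    using star_iff assms a_in_V by (intro collinear_two_points_of_line(3)[of "g i k" "g a i" "g a k" t]) auto
  then show ?thesis using assms(3) by (simp add: spoke_def)
qed

lemma spoke_not_collinear:
  assumes "i \<in> V" "j \<in> V" "k \<in> V" "distinct [i, j, k]"
  shows "\<not> col (spoke i) (g j k)"
proof -
  consider (i_centre) "i = a" | (j_centre) "j = a" | (k_centre) "k = a"
    | (no_centre) "i \<noteq> a" "j \<noteq> a" "k \<noteq> a"
    by blast
  then show ?thesis
  proof cases
    case i_centre
    then show ?thesis using star_iff[of j k] assms by (auto simp: spoke_def)
  next
    case j_centre
    then show ?thesis using spoke_not_collinear_at_centre[of i k] assms by auto
  next
    case k_centre
    then show ?thesis using spoke_not_collinear_at_centre[of i j] edge_commute[of j k] assms by auto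
  next
    case no_centre
    have "\<not> col (g j k) t" "\<not> col (g j k) (g a i)"
      using star_iff[of j k] disjoint_edges[of j k a i] no_centre assms a_in_V col_sym[of t] by auto
    moreover have "g j k \<notin> {t, g a i, spoke i}"
      using spoke_not_edge[of i] t_new edge_pointsI[of j V k g] disjoint_edges[of j k a i] no_centre assms a_in_V
      by auto
    ultimately show ?thesis using line_parity[OF spoke_line[of i]] no_centre assms(1) col_sym by blast
  qed
qed

lemma edge_labelling_cone: "edge_labelling P L (insert v V) cone"
proof unfold_locales
  show "cone i j = cone j i" for i j
    using edge_commute unfolding cone_def by auto
  show "cone i j \<in> P" if "i \<in> insert v V" "j \<in> insert v V" "i \<noteq> j" for i j
    using that spoke_in_P edge_in_points unfolding cone_def by auto
next
  fix i j k assume vertices: "{i, j, k} \<subseteq> insert v V" and distinct: "distinct [i, j, k]"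
  then consider "i = v" "j \<in> V" "k \<in> V" | "j = v" "i \<in> V" "k \<in> V" | "k = v" "i \<in> V" "j \<in> V"
    | "{i, j, k} \<subseteq> V" by auto
  then show "{cone i j, cone j k, cone i k} \<in> L"
    by cases
      (use spokes_line[of j k] spokes_line[of i k] spokes_line[of i j] triangle_line[of i j k] distinct v_new
        in \<open>auto simp: cone_def insert_commute\<close>)
next
  fix i j k l assume vertices: "{i, j, k, l} \<subseteq> insert v V" and distinct: "distinct [i, j, k, l]"
  have spoke: "spoke i \<noteq> g j k \<and> \<not> col (spoke i) (g j k) \<and> \<not> col (g j k) (spoke i)"
    if "{i, j, k} \<subseteq> V" "distinct [i, j, k]" for i j k
    using spoke_not_collinear[of i j k] spoke_not_edge[of i] edge_pointsI[of j V k g] col_sym that by auto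
  consider "i = v" "{j, k, l} \<subseteq> V" | "j = v" "{i, k, l} \<subseteq> V" | "k = v" "{l, i, j} \<subseteq> V"
    | "l = v" "{k, i, j} \<subseteq> V"
    | "{i, j, k, l} \<subseteq> V"
    using vertices distinct by auto
  then show "cone i j \<noteq> cone k l \<and> \<not> col (cone i j) (cone k l)"
    by cases
      (use spoke[of j k l] spoke[of i k l] spoke[of l i j] spoke[of k i j] disjoint_edges[of i j k l]
          distinct v_new
        in \<open>auto simp: cone_def\<close>)
qed

lemma edge_points_cone: "edge_points (insert v V) cone = line_hull L (insert t (edge_points V g))"
proof
  interpret cone: edge_labelling P L "insert v V" cone by (rule edge_labelling_cone)
  let ?H = "line_hull L (insert t (edge_points V g))"
  have base: "insert t (edge_points V g) \<subseteq> ?H" by (rule hull_subset)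
  have "spoke i \<in> ?H" if "i \<in> V" for i
  proof (cases "i = a")
    case True
    then show ?thesis using base by (simp add: spoke_def)
  next
    case False
    then have "g a i \<in> edge_points V g" using that a_in_V by (simp add: edge_pointsI)
    then show ?thesis using line_closedD[OF line_closed_hull spoke_line[OF that False]] base by blast
  qed
  moreover have "g i j \<in> ?H" if "i \<in> V" "j \<in> V" "i \<noteq> j" for i j
    using edge_pointsI[OF that] base by blast
  ultimately show "edge_points (insert v V) cone \<subseteq> ?H"
    unfolding cone_def by (auto elim!: edge_pointsE)
  have "cone i j = g i j" if "i \<in> V" "j \<in> V" for i j
    using that v_new by (auto simp: cone_def)
  then have "g i j \<in> edge_points (insert v V) cone" if "i \<in> V" "j \<in> V" "i \<noteq> j" for i j
    using edge_pointsI[of i "insert v V" j cone] that by simp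
  then have "edge_points V g \<subseteq> edge_points (insert v V) cone"
    by (blast elim: edge_pointsE)
  moreover have "cone v a \<in> edge_points (insert v V) cone"
    using a_in_V v_new by (intro edge_pointsI) auto
  then have "t \<in> edge_points (insert v V) cone" by (simp add: cone_def spoke_def)
  ultimately show "?H \<subseteq> edge_points (insert v V) cone"
    using cone.line_closed_edge_points by (intro hull_minimal) auto
qed

end

lemma star_of_parity_and_balance:
  fixes \<chi> :: "'v \<Rightarrow> 'v \<Rightarrow> bool"
  assumes symmetric: "\<And>i j. \<chi> i j = \<chi> j i"
    and parity: "\<And>i j k. {i, j, k} \<subseteq> V \<Longrightarrow> distinct [i, j, k] \<Longrightarrow> \<chi> i k \<longleftrightarrow> \<chi> i j \<noteq> \<chi> j k"
    and balance: "\<And>i j k l. {i, j, k, l} \<subseteq> V \<Longrightarrow> distinct [i, j, k, l] \<Longrightarrow>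
      (of_bool (\<chi> i j) + of_bool (\<chi> k l) :: nat) = of_bool (\<chi> i k) + of_bool (\<chi> j l)"
    and edge: "a \<in> V" "b \<in> V" "a \<noteq> b" "\<chi> a b"
  obtains c where "c \<in> V" "\<And>i j. i \<in> V \<Longrightarrow> j \<in> V \<Longrightarrow> i \<noteq> j \<Longrightarrow> \<chi> i j \<longleftrightarrow> i = c \<or> j = c"
proof -
  note centreI = that
  have star: thesis if c_edge: "c \<in> V" "\<And>d. d \<in> V \<Longrightarrow> d \<noteq> c \<Longrightarrow> \<chi> c d" for c
  proof (rule centreI[OF c_edge(1)])
    fix i j assume vertices: "i \<in> V" "j \<in> V" "i \<noteq> j"
    show "\<chi> i j \<longleftrightarrow> i = c \<or> j = c"
    proof (cases "i = c \<or> j = c")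
      case False
      then show ?thesis using parity[of i c j] c_edge vertices symmetric[of i c] by auto
    qed (use c_edge(2) vertices symmetric in auto)
  qed
  show thesis
  proof (cases "\<exists>c\<in>V - {a, b}. \<chi> a c")
    case True
    then obtain c where c_edge: "c \<in> V" "c \<noteq> a" "c \<noteq> b" "\<chi> a c" by blast
    then have "\<not> \<chi> b c" using parity[of a b c] edge by auto
    then have "\<chi> a d" if "d \<in> V" "d \<noteq> a" "d \<noteq> b" "d \<noteq> c" for d
      using balance[of a b d c] that c_edge edge by (auto simp: of_bool_def split: if_splits)
    then show ?thesis using star[of a] edge c_edge by metis
  next
    case False
    then have "\<chi> b d" if "d \<in> V" "d \<noteq> a" "d \<noteq> b" for d
      using parity[of a b d] that edge by auto
    then show ?thesis using star[of b] edge symmetric by metis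
  qed
qed

locale jordan_dual_fischer = jordan_matsuo P L \<delta> + dual_fischer_system P L
  for P :: "'a set" and L and \<delta> :: "'f::field"
begin

lemma collinear_edges_star:
  assumes "edge_labelling P L V g" and outside: "t \<in> P" "t \<notin> edge_points V g"
    and p_edge: "p \<in> edge_points V g" "col t p"
  obtains a where "a \<in> V" "\<And>i j. i \<in> V \<Longrightarrow> j \<in> V \<Longrightarrow> i \<noteq> j \<Longrightarrow> col t (g i j) \<longleftrightarrow> i = a \<or> j = a"
proof -
  interpret edge_labelling P L V g by fact
  obtain a b where p_eq: "a \<in> V" "b \<in> V" "a \<noteq> b" "p = g a b" using p_edge(1) by (rule edge_pointsE)
  show thesis
  proof (rule star_of_parity_and_balance[of "\<lambda>i j. col t (g i j)" V a b])
    show "col t (g i k) \<longleftrightarrow> col t (g i j) \<noteq> col t (g j k)"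
      if "{i, j, k} \<subseteq> V" "distinct [i, j, k]" for i j k
    proof (rule line_parity[OF triangle_line[OF that]])
      show "t \<notin> {g i j, g j k, g i k}" using that outside(2) by (auto simp: edge_pointsI)
    qed
    show "(of_bool (col t (g i j)) + of_bool (col t (g k l)) :: nat) =
        of_bool (col t (g i k)) + of_bool (col t (g j l))"
      if "{i, j, k, l} \<subseteq> V" "distinct [i, j, k, l]" for i j k l
      using opposite_edges_balanced[OF assms(1) outside that] by (simp add: col_sym)
  qed (use edge_commute p_eq p_edge(2) that in auto)
qed

theorem edge_labelling_of_rank:
  assumes connected: "connected_system P L" and rank: "has_rank P L n" "n > 0"
  obtains g where "edge_labelling P L {1..n + 1} g" "edge_points {1..n + 1} g = P"
proof -
  define labelled where
    "labelled k Q \<longleftrightarrow> (\<exists>g. edge_labelling P L {1..k + 2::nat} g \<and> edge_points {1..k + 2} g = Q)" for k Q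
  have "labelled (n - 1) P"
    using rank
  proof (induction rule: has_rank_induct)
    case (point p)
    have "edge_labelling P L {1..2::nat} (\<lambda>_ _. p)"
      using point by unfold_locales auto
    moreover have "edge_points {1..2::nat} (\<lambda>_ _. p) = {p}"
      using edge_pointsI[of 1 "{1..2::nat}" 2 "\<lambda>_ _. p"] by (auto elim: edge_pointsE)
    ultimately show ?case unfolding labelled_def by (auto simp: numeral_2_eq_2)
  next
    case (insert k Q S)
    then obtain g where labelling: "edge_labelling P L {1..k + 2} g" "edge_points {1..k + 2} g = Q"
      unfolding labelled_def by blast
    obtain s q where generator: "s \<in> S" "s \<notin> Q" "q \<in> Q" "col s q"
      using connected insert by (elim exists_collinear_generator)
    obtain a where centre: "a \<in> {1..k + 2}"
      "\<And>i j. i \<in> {1..k + 2} \<Longrightarrow> j \<in> {1..k + 2} \<Longrightarrow> i \<noteq> j \<Longrightarrow> col s (g i j) \<longleftrightarrow> i = a \<or> j = a"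
      using collinear_edges_star[OF labelling(1), of s q] generator labelling(2) insert by auto
    interpret edge_labelling P L "{1..k + 2}" g by (rule labelling(1))
    interpret edge_star P L "{1..k + 2}" g s a "k + 3"
      by unfold_locales (use generator labelling(2) centre insert in auto)
    have "Set.insert (k + 3) {1..k + 2} = {1..Suc k + 2}" by auto
    then have "labelled (Suc k) (line_hull L (Set.insert s Q))"
      unfolding labelled_def using edge_labelling_cone edge_points_cone labelling(2) by auto
    then show ?case using generator by blast
  qed
  moreover have "n - 1 + 2 = n + 1" using rank(2) by simp
  ultimately show thesis using that unfolding labelled_def by auto
qed

end

section \<open>Medial triple systems\<close>

locale steiner_triple_system = triple_system P L for P :: "'a set" and L +
  assumes all_collinear: "p \<in> P \<Longrightarrow> q \<in> P \<Longrightarrow> p \<noteq> q \<Longrightarrow> col p q"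
begin

lemma star_line: "p \<in> P \<Longrightarrow> q \<in> P \<Longrightarrow> p \<noteq> q \<Longrightarrow> {p, q, p \<star> q} \<in> L"
  using third_line[OF all_collinear] by (simp add: star_def)

lemma star_in_P [simp]: "p \<in> P \<Longrightarrow> q \<in> P \<Longrightarrow> p \<star> q \<in> P"
  using line_points(3)[OF star_line] by (cases "p = q") auto

lemma star_star_left [simp]:
  assumes "p \<in> P" "q \<in> P"
  shows "p \<star> (p \<star> q) = q"
proof (cases "p = q")
  case False
  then have "{p, p \<star> q, q} \<in> L" using star_line[OF assms] by (simp add: insert_commute)
  then show ?thesis by (rule star_eq)
qed simp

lemma star_star_right [simp]: "p \<in> P \<Longrightarrow> q \<in> P \<Longrightarrow> (q \<star> p) \<star> p = q"
  using star_star_left star_commute by metis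

lemma star_cancel: "p \<in> P \<Longrightarrow> q \<in> P \<Longrightarrow> r \<in> P \<Longrightarrow> p \<star> q = p \<star> r \<longleftrightarrow> q = r"
  using star_star_left by metis

lemma star_eq_iff: "p \<in> P \<Longrightarrow> q \<in> P \<Longrightarrow> r \<in> P \<Longrightarrow> p \<star> q = r \<longleftrightarrow> q = p \<star> r"
  using star_star_left by metis

lemma line_closed_star:
  assumes "line_closed L Q" "Q \<subseteq> P" "p \<in> Q" "q \<in> Q"
  shows "p \<star> q \<in> Q"
  using assms star_line[of p q] line_closedD[OF assms(1)] by (cases "p = q") auto

end

locale medial_triple_system = steiner_triple_system P L for P :: "'a set" and L +
  assumes medial: "a \<in> P \<Longrightarrow> b \<in> P \<Longrightarrow> c \<in> P \<Longrightarrow> d \<in> P \<Longrightarrow> (a \<star> b) \<star> (c \<star> d) = (a \<star> c) \<star> (b \<star> d)"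
begin

lemma star_distrib:
  assumes "p \<in> P" "q \<in> P" "r \<in> P"
  shows "p \<star> (q \<star> r) = (p \<star> q) \<star> (p \<star> r)"
  using medial[of p p q r] assms by simp

end

lemma three_cases: "(c::3) = 0 \<or> c = 1 \<or> c = 2"
proof (cases c)
  case (of_int z)
  then have "z = 0 \<or> z = 1 \<or> z = 2" by auto
  then show ?thesis using of_int by auto
qed

lemma three_distinct:
  fixes c d :: 3
  assumes "c \<noteq> d"
  shows "0 \<in> {c, d, - c - d}" "1 \<in> {c, d, - c - d}"
  using three_cases[of c] three_cases[of d] assms by (elim disjE; simp)+

text \<open>With \<open>f 0\<close> as origin, the sum of \<open>p\<close> and \<open>q\<close> is \<open>f 0 \<star> (p \<star> q)\<close>. The labelling of a closed set is
  extended by the multiples of a further point \<open>t\<close>.\<close>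

locale affine_extension = medial_triple_system P L + affine_labelling P L k f
  for P :: "'a set" and L k f +
  fixes t :: 'a
  assumes t_in_P: "t \<in> P" and t_new: "t \<notin> f ` affine_points k"
begin

definition multiple :: "3 \<Rightarrow> 'a" where
  "multiple c = (if c = 0 then f 0 else if c = 1 then t else f 0 \<star> t)"

definition extension :: "(nat \<Rightarrow> 3) \<Rightarrow> 'a" where
  "extension u = f 0 \<star> (f (u(k := 0)) \<star> multiple (u k))"

lemma origin_in_P: "f 0 \<in> P"
  by (rule label_point) (rule zero_in_affine_points)

lemma multiple_in_P: "multiple c \<in> P"
  using origin_in_P t_in_P by (simp add: multiple_def)

lemma truncate_in_affine_points: "u \<in> affine_points (Suc k) \<Longrightarrow> u(k := 0) \<in> affine_points k"
  by (simp add: affine_points_def)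

lemma truncated_label_in_P: "u \<in> affine_points (Suc k) \<Longrightarrow> f (u(k := 0)) \<in> P"
  by (rule label_point) (rule truncate_in_affine_points)

lemma extension_in_P: "u \<in> affine_points (Suc k) \<Longrightarrow> extension u \<in> P"
  using origin_in_P multiple_in_P truncated_label_in_P by (simp add: extension_def)

lemma multiple_star: "multiple c \<star> multiple d = multiple (- c - d)"
proof -
  have "f 0 \<star> t \<star> f 0 = t" "t \<star> f 0 = f 0 \<star> t" "t \<star> (f 0 \<star> t) = f 0" "f 0 \<star> t \<star> t = f 0"
    using origin_in_P t_in_P star_commute star_star_left star_star_right by metis+
  then show ?thesis
    using three_cases[of c] three_cases[of d] origin_in_P t_in_P
    by (elim disjE) (simp_all add: multiple_def)
qed

lemma extension_star:
  assumes u_in: "u \<in> affine_points (Suc k)" and v_in: "v \<in> affine_points (Suc k)"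
  shows "extension u \<star> extension v = extension (- u - v)"
proof -
  let ?fu = "f (u(k := 0))" and ?fv = "f (v(k := 0))"
  have in_P: "f 0 \<in> P" "?fu \<in> P" "?fv \<in> P" "multiple (u k) \<in> P" "multiple (v k) \<in> P"
    using u_in v_in origin_in_P multiple_in_P truncated_label_in_P by simp_all
  have "extension u \<star> extension v = f 0 \<star> ((?fu \<star> multiple (u k)) \<star> (?fv \<star> multiple (v k)))"
    unfolding extension_def using in_P by (intro star_distrib[symmetric]) auto
  also have "\<dots> = f 0 \<star> ((?fu \<star> ?fv) \<star> (multiple (u k) \<star> multiple (v k)))"
    using in_P by (simp add: medial[of ?fu])
  also have "?fu \<star> ?fv = f (- u(k := 0) - v(k := 0))"
    using u_in v_in truncate_in_affine_points label_star by simp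
  also have "- u(k := 0) - v(k := 0) = (- u - v)(k := 0)"
    by (simp add: fun_eq_iff)
  also have "multiple (u k) \<star> multiple (v k) = multiple ((- u - v) k)"
    by (simp add: multiple_star)
  finally show ?thesis unfolding extension_def .
qed

lemma extension_eqD:
  assumes u_in: "u \<in> affine_points (Suc k)" and v_in: "v \<in> affine_points (Suc k)"
    and equal: "extension u = extension v"
  shows "u = v"
proof -
  have "u k = v k"
  proof (rule ccontr)
    assume different: "u k \<noteq> v k"
    define w where "w = - u - v"
    have w_in: "w \<in> affine_points (Suc k)"
      unfolding w_def using u_in v_in by (rule affine_points_closed)
    have "extension w = extension u"
      unfolding w_def extension_star[OF u_in v_in, symmetric] using equal by simp
    then have same: "extension x = extension u" if "x \<in> {u, v, w}" for x using that equal by auto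
    have "w k = - u k - v k" by (simp add: w_def)
    then obtain x y where x_y_in_line: "x \<in> {u, v, w}" "y \<in> {u, v, w}" "x k = 0" "y k = 1"
      using three_distinct[OF different] by (metis insert_iff singletonD)
    then have mem: "x \<in> affine_points (Suc k)" "y \<in> affine_points (Suc k)" using u_in v_in w_in by auto
    have "f 0 \<star> (f (x(k := 0)) \<star> f 0) = f 0 \<star> (f (y(k := 0)) \<star> t)"
      using same[OF x_y_in_line(1)] same[OF x_y_in_line(2)] x_y_in_line(3,4)
      by (simp add: extension_def multiple_def)
    then have "f (x(k := 0)) \<star> f 0 = f (y(k := 0)) \<star> t"
      using origin_in_P t_in_P mem truncated_label_in_P by (simp add: star_cancel)
    then have "t = f (y(k := 0)) \<star> (f (x(k := 0)) \<star> f 0)"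
      using t_in_P mem truncated_label_in_P by simp
    also have "\<dots> \<in> f ` affine_points k"
      using mem truncate_in_affine_points zero_in_affine_points
      by (intro line_closed_star[OF line_closed_labels labels_subset] imageI)
    finally show False using t_new by simp
  qed
  moreover have "f (u(k := 0)) = f (v(k := 0))"
    using equal origin_in_P multiple_in_P truncated_label_in_P[OF u_in] truncated_label_in_P[OF v_in] \<open>u k = v k\<close>
    unfolding extension_def by (metis star_cancel star_commute star_in_P)
  then have "u(k := 0) = v(k := 0)"
    using u_in v_in truncate_in_affine_points by (simp add: label_eq_iff)
  ultimately show ?thesis by (metis fun_upd_triv fun_upd_upd)
qed

lemma affine_labelling_extension: "affine_labelling P L (Suc k) extension"
proof unfold_locales
  fix u v assume labels: "u \<in> affine_points (Suc k)" "v \<in> affine_points (Suc k)" "u \<noteq> v"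
  then have "extension u \<noteq> extension v" using extension_eqD by blast
  then show "{extension u, extension v, extension (- u - v)} \<in> L"
    using star_line extension_in_P extension_star labels by metis
qed (rule extension_in_P)

lemma labels_extension:
  "extension ` affine_points (Suc k) = line_hull L (insert t (f ` affine_points k))"
proof
  let ?H = "line_hull L (insert t (f ` affine_points k))"
  have generators: "insert t (f ` affine_points k) \<subseteq> ?H" by (rule hull_subset)
  have "insert t (f ` affine_points k) \<subseteq> P" using t_in_P labels_subset by blast
  note star = line_closed_star[OF line_closed_hull line_hull_subset[OF this]]
  have "f 0 \<in> ?H" "t \<in> ?H" using generators zero_in_affine_points by auto
  then have "multiple c \<in> ?H" for c using star by (simp add: multiple_def)
  moreover have "f (u(k := 0)) \<in> ?H" if "u \<in> affine_points (Suc k)" for u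
    using generators truncate_in_affine_points[OF that] by blast
  ultimately have "extension u \<in> ?H" if "u \<in> affine_points (Suc k)" for u
    using star \<open>f 0 \<in> ?H\<close> that by (simp add: extension_def)
  then show "extension ` affine_points (Suc k) \<subseteq> ?H" by blast
  interpret extension: affine_labelling P L "Suc k" extension by (rule affine_labelling_extension)
  have "f u \<in> extension ` affine_points (Suc k)" if "u \<in> affine_points k" for u
  proof
    show "u \<in> affine_points (Suc k)" using that by (simp add: affine_points_def)
    have "u k = 0" using that by (simp add: affine_points_def)
    then have "u(k := 0) = u" by (simp add: fun_upd_idem)
    then show "f u = extension u"
      using \<open>u k = 0\<close> origin_in_P label_point[OF that] star_commute[of "f u"]
      by (simp add: extension_def multiple_def)
  qed
  moreover have "t \<in> extension ` affine_points (Suc k)"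
  proof
    show "0(k := 1) \<in> affine_points (Suc k)" by (simp add: affine_points_def)
    have "(0 :: nat \<Rightarrow> 3)(k := 0) = 0" by (simp add: fun_eq_iff)
    then show "t = extension (0(k := 1))"
      using origin_in_P t_in_P by (simp add: extension_def multiple_def)
  qed
  ultimately show "?H \<subseteq> extension ` affine_points (Suc k)"
    using extension.line_closed_labels by (intro hull_minimal) auto
qed

end

theorem (in medial_triple_system) affine_labelling_of_rank:
  assumes "has_rank P L n" "n > 0"
  obtains f where "affine_labelling P L (n - 1) f" "f ` affine_points (n - 1) = P"
proof -
  define labelled where
    "labelled k Q \<longleftrightarrow> (\<exists>f. affine_labelling P L k f \<and> f ` affine_points k = Q)" for k Q
  have "labelled (n - 1) P"
    using assms
  proof (induction rule: has_rank_induct)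
    case (point p)
    have "affine_points 0 = {0}" by (auto simp: affine_points_def)
    moreover have "affine_labelling P L 0 (\<lambda>_. p)"
      using point by unfold_locales (auto simp: \<open>affine_points 0 = {0}\<close>)
    ultimately show ?case unfolding labelled_def by auto
  next
    case (insert k Q S)
    then obtain f where labelling: "affine_labelling P L k f" "f ` affine_points k = Q"
      unfolding labelled_def by blast
    have "\<not> S \<subseteq> Q" using insert hull_minimal[of S Q "line_closed L"] by auto
    then obtain s where generator: "s \<in> S" "s \<notin> Q" by blast
    interpret affine_labelling P L k f by (rule labelling(1))
    interpret affine_extension P L k f s
      by unfold_locales (use generator labelling(2) insert in auto)
    have "labelled (Suc k) (line_hull L (Set.insert s Q))"
      unfolding labelled_def using affine_labelling_extension labels_extension labelling(2) by blast
    then show ?case using generator by blast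
  qed
  then show thesis using that unfolding labelled_def by blast
qed

section \<open>Fischer spaces with an affine plane\<close>

locale jordan_fischer = jordan_matsuo P L \<delta> + fischer_system P L
  for P :: "'a set" and L and \<delta> :: "'f::field"
begin

lemma affine_plane_collinear_iff:
  assumes plane: "affine_plane Q" and outside: "t \<in> P" "t \<notin> Q" and in_plane: "x \<in> Q" "y \<in> Q"
  shows "col x t \<longleftrightarrow> col y t"
proof (cases "x = y")
  case False
  obtain f where labelling: "affine_labelling P L 2 f" "f ` affine_points 2 = Q"
    using plane unfolding affine_plane_def by blast
  then obtain u v where labels: "u \<in> affine_points 2" "v \<in> affine_points 2" "x = f u" "y = f v"
    using in_plane by blast
  obtain w where "w \<in> affine_points 2" "w \<notin> {u, v, - u - v}"
    using affine_plane_point_outside by blast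
  then show ?thesis
    using collinear_affine_labels[OF labelling(1), of t u v w] outside labelling(2) labels False by blast
qed simp

lemma affine_plane_through_collinear:
  assumes plane: "affine_plane Q" "x \<in> Q" and collinear_t: "col x t"
  obtains R where "affine_plane R" "x \<in> R" "t \<in> R"
proof (cases "t \<in> Q")
  case True
  then show ?thesis using that plane by blast
next
  case False
  obtain f where labelling: "affine_labelling P L 2 f" "f ` affine_points 2 = Q"
    using plane(1) unfolding affine_plane_def by blast
  interpret affine_labelling P L 2 f by (rule labelling(1))
  obtain u where x_label: "u \<in> affine_points 2" "x = f u" using plane(2) labelling(2) by blast
  obtain v where second_label: "v \<in> affine_points 2" "v \<notin> {u, u, u}"
    using affine_plane_point_outside by blast
  define l where "l = {f u, f v, f (- u - v)}"
  have line: "l \<in> L" "l \<subseteq> Q" "x \<in> l"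
    unfolding l_def using label_line[of u v] x_label second_label labelling(2) affine_points_closed by auto
  have collinear: "col t y" if "y \<in> l" for y
    using affine_plane_collinear_iff[OF plane(1) _ False plane(2), of y] that line(2) collinear_t
      col_points(2)[OF collinear_t] col_sym by blast
  have "t \<notin> l" using line(2) False by blast
  with line(1) obtain R where "affine_plane R" "l \<subseteq> R" "t \<in> R"
    using collinear by (rule affine_plane_of_collinear_lineE)
  then show ?thesis using that line(3) by blast
qed

lemma affine_plane_all_collinear:
  assumes connected: "connected_system P L" and plane: "affine_plane Q"
    and points: "p \<in> P" "q \<in> P" "p \<noteq> q"
  shows "col p q"
proof -
  obtain o' where o_in_Q: "o' \<in> Q"
    using plane affine_plane_point_outside unfolding affine_plane_def by blast
  then have "o' \<in> P" using affine_plane_closed(2)[OF plane] by blast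
  have "\<exists>R. affine_plane R \<and> p \<in> R"
    using connected \<open>o' \<in> P\<close> points(1)
  proof (induction rule: connected_system_induct)
    case (step x y)
    then show ?case using affine_plane_through_collinear by metis
  qed (use plane o_in_Q in blast)
  then obtain R where plane_p: "affine_plane R" "p \<in> R" by blast
  have "q = p \<or> col p q"
    using connected points(1,2)
  proof (induction rule: connected_system_induct)
    case (step x y)
    show ?case
    proof (cases "x = p \<or> y = p")
      case False
      then have "col p x" using step by blast
      then obtain S where plane_p_x: "affine_plane S" "p \<in> S" "x \<in> S"
        by (rule affine_plane_through_collinear[OF plane_p])
      then show ?thesis
        using affine_plane_collinear[OF plane_p_x(1,2), of y]
          affine_plane_collinear_iff[OF plane_p_x(1) _ _ plane_p_x(2,3), of y] col_points(2)[OF step(2)] step(2) by blast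
    qed (use step in auto)
  qed simp
  then show ?thesis using points(3) by simp
qed

end

locale steiner_fischer_system = steiner_triple_system P L + fischer_system P L
  for P :: "'a set" and L
begin

lemma plane_through_point_off_line:
  assumes "p \<in> P" "q \<in> P" "r \<in> P" "p \<noteq> q" "r \<notin> {p, q, p \<star> q}"
  obtains Q where "affine_plane Q" "{p, q, r} \<subseteq> Q"
proof -
  have line: "{p, q, p \<star> q} \<in> L" using star_line assms by blast
  have collinear: "col r x" if "x \<in> {p, q, p \<star> q}" for x
    using all_collinear[of r x] that assms by auto
  obtain Q where "affine_plane Q" "{p, q, p \<star> q} \<subseteq> Q" "r \<in> Q"
    using line assms(5) collinear by (rule affine_plane_of_collinear_lineE)
  then show ?thesis using that by simp
qed

lemma star_distrib:
  assumes in_P: "p \<in> P" "q \<in> P" "r \<in> P"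
  shows "p \<star> (q \<star> r) = (p \<star> q) \<star> (p \<star> r)"
proof -
  consider (p_q) "p = q" | (r_p) "r = p" | (r_q) "r = q" | (r_third) "r = p \<star> q"
    | (off_line) "p \<noteq> q" "r \<notin> {p, q, p \<star> q}"
    by blast
  then show ?thesis
  proof cases
    case r_p
    then show ?thesis using star_commute by simp
  next
    case r_third
    then show ?thesis using in_P star_star_left[of q p] star_commute[of q p] by simp
  next
    case off_line
    then obtain Q where plane: "affine_plane Q" "{p, q, r} \<subseteq> Q"
      using plane_through_point_off_line in_P by blast
    then obtain f where labelling: "affine_labelling P L 2 f" "f ` affine_points 2 = Q"
      unfolding affine_plane_def by blast
    interpret affine_labelling P L 2 f by (rule labelling(1))
    have "p \<in> f ` affine_points 2" "q \<in> f ` affine_points 2" "r \<in> f ` affine_points 2"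
      using plane(2) labelling(2) by simp_all
    then obtain u v w where labels: "u \<in> affine_points 2" "v \<in> affine_points 2" "w \<in> affine_points 2"
      "p = f u" "q = f v" "r = f w"
      by (elim imageE)
    have label_identity: "- u - (- v - w) = - (- u - v) - (- u - w)"
      by (simp add: algebra_simps two_eq_minus_one)
    have "p \<star> (q \<star> r) = f (- u - (- v - w))"
      using labels by (simp only: label_star affine_points_closed)
    also have "\<dots> = (p \<star> q) \<star> (p \<star> r)"
      unfolding label_identity using labels by (simp only: label_star affine_points_closed)
    finally show ?thesis .
  qed (use in_P in auto)
qed

end

locale jordan_steiner_fischer = jordan_matsuo P L \<delta> + steiner_fischer_system P L
  for P :: "'a set" and L and \<delta> :: "'f::field" +
  assumes delta_one: "\<delta> = 1"
begin

lemma ax_star: "p \<in> P \<Longrightarrow> q \<in> P \<Longrightarrow> ax p \<bullet> ax q = ax p + ax q - ax (p \<star> q)"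
  using ax_line[OF star_line] by (cases "p = q") (auto simp: matsuo_mult_axis axis_mult_def delta_one)

lemma linearized_jordan_star:
  assumes in_P: "p \<in> P" "q \<in> P" "s \<in> P" "t \<in> P"
  shows "ax (s \<star> ((p \<star> q) \<star> t)) + ax (p \<star> ((q \<star> s) \<star> t)) + ax (q \<star> ((s \<star> p) \<star> t)) =
    ax ((p \<star> q) \<star> (s \<star> t)) + ax ((q \<star> s) \<star> (p \<star> t)) + ax ((s \<star> p) \<star> (q \<star> t))"
  using linearized_jordan_axes[OF in_P]
  by (simp add: ax_star in_P matsuo_mult_bilinear star_commute[of q p] star_commute[of s q] star_commute[of p s]
      star_commute[of "p \<star> q" s] star_commute[of "q \<star> s" p] star_commute[of "s \<star> p" q]) (simp add: algebra_simps)

lemma ax_eq_iff: "ax p = ax q \<longleftrightarrow> p = q"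
  by (metis lookup_axis of_bool_eq_1_iff)

lemma ax_sum_eqD:
  assumes "ax a + ax b + ax c = ax a' + ax b' + ax c'" "a \<noteq> b"
  shows "a \<in> {a', b', c'}"
proof (rule ccontr)
  assume "a \<notin> {a', b', c'}"
  then have "cf (ax a + ax b + ax c) a = 0"
    unfolding assms(1) by (auto simp: lookup_add lookup_axis)
  then have "(1::'f) + of_bool (c = a) = 0" using assms(2) by (simp add: lookup_add lookup_axis)
  then show False using two_nonzero by (simp add: of_bool_def split: if_splits)
qed

text \<open>With \<open>t\<close> as the origin, \<open>(p \<star> q) \<star> (s \<star> t)\<close> is the sum \<open>(p + q) + s\<close>. The linearized identity says
  that the formal sum of the three ways of adding \<open>p\<close>, \<open>q\<close>, \<open>s\<close> is invariant under negation, which forces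
  them to agree.\<close>

lemma star_sum_eq_origin_iff:
  assumes "p \<in> P" "q \<in> P" "s \<in> P" "t \<in> P"
  shows "(p \<star> q) \<star> (s \<star> t) = t \<longleftrightarrow> p \<star> q = s"
proof -
  have "(p \<star> q) \<star> (s \<star> t) = t \<longleftrightarrow> s \<star> t = (p \<star> q) \<star> t" using assms by (simp add: star_eq_iff)
  also have "\<dots> \<longleftrightarrow> p \<star> q = s" using assms star_cancel[of t s "p \<star> q"] by (simp add: star_commute[of _ t]) blast
  finally show ?thesis .
qed

lemma eq_of_ax_sum_star_invariant:
  assumes "ax a + ax b + ax c = ax (t \<star> a) + ax (t \<star> b) + ax (t \<star> c)"
    and in_P: "a \<in> P" "b \<in> P" "c \<in> P" "t \<in> P" and not_origin: "a \<noteq> t" "b \<noteq> t" "c \<noteq> t"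
  shows "a = b"
proof (rule ccontr)
  assume "a \<noteq> b"
  have not_fixed: "t \<star> x \<noteq> x" if "x \<in> P" "x \<noteq> t" for x
    using that in_P(4) star_star_right star_idem by metis
  consider (fixed) "a = t \<star> a" | (swap_b) "a = t \<star> b" | (swap_c) "a = t \<star> c"
    using ax_sum_eqD[OF assms(1) \<open>a \<noteq> b\<close>] by blast
  then show False
  proof cases
    case fixed
    then show ?thesis using not_fixed[of a] in_P not_origin by simp
  next
    case swap_b
    then have "t \<star> a = b" using in_P by simp
    then have "ax c = ax (t \<star> c)" using assms(1) swap_b by (simp add: add.commute)
    then show ?thesis using not_fixed[of c] in_P not_origin by (simp add: ax_eq_iff)
  next
    case swap_c
    then have "t \<star> a = c" using in_P by simp
    then have "ax b = ax (t \<star> b)" using assms(1) swap_c by (simp add: algebra_simps)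
    then show ?thesis using not_fixed[of b] in_P not_origin by (simp add: ax_eq_iff)
  qed
qed

lemma star_sum_commute:
  assumes in_P: "p \<in> P" "q \<in> P" "s \<in> P" "t \<in> P"
  shows "(p \<star> q) \<star> (s \<star> t) = (q \<star> s) \<star> (p \<star> t)"
proof -
  define A where "A = (p \<star> q) \<star> (s \<star> t)"
  define B where "B = (q \<star> s) \<star> (p \<star> t)"
  define C where "C = (s \<star> p) \<star> (q \<star> t)"
  note sums = A_def B_def C_def
  have mem: "A \<in> P" "B \<in> P" "C \<in> P" unfolding sums using in_P by auto
  have "t \<star> ((a \<star> b) \<star> (c \<star> t)) = c \<star> ((a \<star> b) \<star> t)" if "a \<in> P" "b \<in> P" "c \<in> P" for a b c
    using star_distrib[of t "a \<star> b" "c \<star> t"] in_P that star_commute[of c "(a \<star> b) \<star> t"]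
      star_commute[of t "a \<star> b"] star_commute[of t "c \<star> t"] by simp
  then have invariant: "ax A + ax B + ax C = ax (t \<star> A) + ax (t \<star> B) + ax (t \<star> C)"
    using linearized_jordan_star[OF in_P] in_P unfolding sums by simp
  have "p \<star> q = s \<longleftrightarrow> q \<star> s = p" "s \<star> p = q \<longleftrightarrow> q \<star> s = p"
    using in_P star_eq_iff star_commute by metis+
  then have origin_iff: "A = t \<longleftrightarrow> B = t" "C = t \<longleftrightarrow> B = t"
    unfolding sums using star_sum_eq_origin_iff in_P by simp_all
  have "A = B"
  proof (cases "B = t")
    case False
    then show ?thesis using eq_of_ax_sum_star_invariant[OF invariant mem in_P(4)] origin_iff by blast
  qed (use origin_iff in simp)
  then show ?thesis unfolding sums .
qed

sublocale medial_triple_system P L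
proof unfold_locales
  fix a b c d assume "a \<in> P" "b \<in> P" "c \<in> P" "d \<in> P"
  then show "(a \<star> b) \<star> (c \<star> d) = (a \<star> c) \<star> (b \<star> d)"
    using star_sum_commute[of b a c d] star_commute by metis
qed

end

section \<open>The classification\<close>

theorem (in jordan_fischer) edge_or_affine_labelling:
  assumes "connected_system P L" "has_rank P L n" "n > 0" "\<delta> = 1"
  shows "(\<exists>g. edge_labelling P L {1..n + 1} g \<and> edge_points {1..n + 1} g = P) \<or>
    (\<exists>f. affine_labelling P L (n - 1) f \<and> f ` affine_points (n - 1) = P)"
proof (cases "\<exists>Q. affine_plane Q")
  case True
  then obtain Q where plane: "affine_plane Q" ..
  interpret jordan_steiner_fischer P L \<delta>
    by unfold_locales (fact affine_plane_all_collinear[OF assms(1) plane] assms(4))+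
  obtain f where "affine_labelling P L (n - 1) f" "f ` affine_points (n - 1) = P"
    using assms(2,3) by (rule affine_labelling_of_rank)
  then show ?thesis by blast
next
  case False
  then interpret jordan_dual_fischer P L \<delta>
    by unfold_locales blast
  obtain g where "edge_labelling P L {1..n + 1} g" "edge_points {1..n + 1} g = P"
    using assms(1-3) by (rule edge_labelling_of_rank)
  then show ?thesis by blast
qed

lemma char_three_quarter:
  assumes "CHAR('f::field) = 3"
  shows "(1 / 4 :: 'f) = 1" "(2::'f) \<noteq> 0"
proof -
  have three: "(3::'f) = 0" using assms by (metis of_nat_CHAR of_nat_numeral)
  have "(4::'f) = 3 + 1" by simp
  then show "(1 / 4 :: 'f) = 1" unfolding three by simp
  have "(3::'f) = 2 + 1" by simp
  then show "(2::'f) \<noteq> 0" unfolding three by (metis add_0 zero_neq_one)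
qed

theorem mainTheorem1:
  fixes n :: nat and P :: "'a set" and L :: "'a set set"
  assumes "n > 0"
    and "fischer_space P L"
    and "connected_system P L"
    and "has_rank P L n"
    and "CHAR('f::field) = 3"
  shows "jordan_algebra pm_scale (matsuo_carrier P) (matsuo_mult L (1 / 4 :: 'f)) \<longleftrightarrow>
    isomorphic_systems P L
      (transpositions (n + 1)) (fischer_lines (sym_group (n + 1)) (transpositions (n + 1))) \<or>
    isomorphic_systems P L (affine_points (n - 1)) (affine_lines (n - 1))"
    (is "?jordan \<longleftrightarrow> ?symmetric \<or> ?affine")
proof
  note quarter = char_three_quarter[OF assms(5)]
  interpret fischer_system P L
    using assms(2) by unfold_locales (auto simp: fischer_space_def)
  show "?symmetric \<or> ?affine" if ?jordan
  proof -
    interpret jordan_fischer P L "1 / 4 :: 'f"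
      using that quarter by unfold_locales auto
    show ?thesis
      using edge_or_affine_labelling[OF assms(3,4,1) quarter(1)]
        edge_labelling_isomorphic_transpositions affine_labelling.isomorphic_affine by blast
  qed
  show ?jordan if "?symmetric \<or> ?affine"
    using that
  proof
    assume ?symmetric
    then show ?jordan
      using isomorphic_transpositionsE edge_labelling.jordan_algebra_complete_graph quarter(2) by metis
  next
    assume ?affine
    then obtain f where "affine_labelling P L (n - 1) f" "f ` affine_points (n - 1) = P"
      using isomorphic_affineE[of P] lines_within_points by auto
    then show ?jordan
      using affine_labelling.jordan_algebra_affine assms(5) quarter(1) by metis
  qed
qed

end
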